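(* Let $\mathcal{R}$ be an arborable (treeable) Borel equivalence relation with countable classes on a standard Borel space $X$. Then every sub-relation $\mathcal{S}$ of $\mathcal{R}$ is arborable.
   Context: A sub-relation of $\mathcal{R}$ is a Borel equivalence relation on $X$ contained in $\mathcal{R}$. A Borel equivalence relation with countable classes on a standard Borel space $X$ is arborable (treeable) if there is a symmetric Borel subset of $X\times X$ disjoint from the diagonal which, seen as a graph on $X$, is acyclic and whose connected components are exactly the classes of the relation. *)

theory Defs
  imports "HOL-Analysis.Analysis"
begin

text \<open>
  A measurable space is represented by a value of type \<^typ>\<open>'a measure\<close>, of which only
  the underlying set and the \<open>\<sigma>\<close>-algebra are used.
\<close>

definition polish_topology :: "'a topology \<Rightarrow> bool" where
  "polish_topology T \<longleftrightarrow> completely_metrizable_space T \<and> separable_space T"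

definition standard_borel_space :: "'a measure \<Rightarrow> bool" where
  "standard_borel_space X \<longleftrightarrow>
     (\<exists>T. polish_topology T \<and> topspace T = space X \<and>
          sets X = sigma_sets (space X) {U. openin T U})"

definition borel_equiv_rel :: "'a measure \<Rightarrow> ('a \<times> 'a) set \<Rightarrow> bool" where
  "borel_equiv_rel X R \<longleftrightarrow> R \<in> sets (X \<Otimes>\<^sub>M X) \<and> equiv (space X) R"

definition countable_classes :: "'a measure \<Rightarrow> ('a \<times> 'a) set \<Rightarrow> bool" where
  "countable_classes X R \<longleftrightarrow> (\<forall>C \<in> space X // R. countable C)"

definition sub_relation :: "'a measure \<Rightarrow> ('a \<times> 'a) set \<Rightarrow> ('a \<times> 'a) set \<Rightarrow> bool" where
  "sub_relation X R S \<longleftrightarrow> borel_equiv_rel X S \<and> S \<subseteq> R"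

text \<open>
  A simple graph is given by its symmetric irreflexive edge relation.  The library's
  \<^const>\<open>acyclic\<close> concerns directed cycles and fails for every nonempty symmetric relation,
  so acyclicity is stated for simple cycles of length at least 3.
\<close>

definition graph_cycle :: "('a \<times> 'a) set \<Rightarrow> 'a list \<Rightarrow> bool" where
  "graph_cycle G p \<longleftrightarrow> 3 \<le> length p \<and> distinct p \<and>
     (\<forall>i < length p. (p ! i, p ! (Suc i mod length p)) \<in> G)"

definition graph_acyclic :: "('a \<times> 'a) set \<Rightarrow> bool" where
  "graph_acyclic G \<longleftrightarrow> (\<nexists>p. graph_cycle G p)"

definition graph_components :: "'a set \<Rightarrow> ('a \<times> 'a) set \<Rightarrow> 'a set set" where
  "graph_components V G = {G\<^sup>* `` {x} | x. x \<in> V}"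

definition arborable :: "'a measure \<Rightarrow> ('a \<times> 'a) set \<Rightarrow> bool" where
  "arborable X R \<longleftrightarrow>
     (\<exists>G \<in> sets (X \<Otimes>\<^sub>M X). sym G \<and> G \<inter> Id = {} \<and> graph_acyclic G \<and>
        graph_components (space X) G = space X // R)"

end

(*
Idea. Let G be a Borel acyclic graph whose components are the R-classes. Inside an R-class fix an
S-class C and send every vertex to a neighbour that is one step closer to C; following these
moves leads to a root in C, and the vertices with a given root form a connected cell containing
exactly one point of C. Contracting the cells of a tree gives a tree, here with vertex set C.

To do this in a Borel way, the neighbour must be chosen from a countable set and quantifiers
over an R-class must be countable. Both follow once R is covered by the graphs of countably many
Borel functions (Lusin-Novikov). This is proved in Baire space: if no countable family of Borel
functions covers a Suslin set, then its pieces can be split again and again over a common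
first coordinate, which produces a Cantor set inside one section. If some piece had no such
splitting, the part of it not yet covered would be the graph of a Suslin partial function, and
Lusin separation applied to each coordinate extends it to a total Borel function. Asking for
total functions avoids any theorem on Borel injective images.
*)

theory Submission
  imports Defs
begin

section \<open>Suslin sets and Lusin separation\<close>

text \<open>An \<open>R\<close>-class contains many \<open>S\<close>-classes in general, and each
  needs its own contraction of the same tree. The root map therefore has two arguments, a base point
  and a vertex, and has to be Borel on the product. An edge \<open>(a, b)\<close> is decided by the
  cells computed from the class of \<open>a\<close>; \<open>b\<close> computes the same cells
  because it lies in the same class. The obstacle in the covering theorem is that being uncovered is
  a property of single sections: two large pieces may be large over different points. Largeness is
  therefore measured for a family of pieces at once, and a splitting has to keep the whole family
  large. Values are taken in Baire space because a function into it is a sequence of functions into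
  the natural numbers, each found as the least index of a Borel set containing the argument. The
  passage to a standard Borel space goes through a Borel map \<open>e\<close> into Baire space with
  a Borel left inverse \<open>L\<close>.\<close>

instantiation nat :: metric_space
begin

definition dist_nat_def: "dist m n = \<bar>real m - real n\<bar>"

definition uniformity_nat_def [code del]:
  "(uniformity :: (nat \<times> nat) filter) = (INF e\<in>{0 <..}. principal {(x, y). dist x y < e})"

instance
proof
  show "(uniformity :: (nat \<times> nat) filter) = (INF e\<in>{0 <..}. principal {(x, y). dist x y < e})"
    by (rule uniformity_nat_def)
  have ev: "(\<forall>\<^sub>F (x', y) in uniformity. x' = x \<longrightarrow> y \<in> U)" if "x \<in> U" for x :: nat and U
    unfolding uniformity_nat_def
  proof (rule eventually_INF1[of 1])
    have "y = x" if "\<bar>real x - real y\<bar> < 1" for y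
      using that by linarith
    then show "\<forall>\<^sub>F (x', y) in principal {(x, y). dist x y < 1}. x' = x \<longrightarrow> y \<in> U"
      using that by (auto simp: eventually_principal dist_nat_def)
  qed simp
  then show "open U \<longleftrightarrow> (\<forall>x\<in>U. \<forall>\<^sub>F (x', y) in uniformity. x' = x \<longrightarrow> y \<in> U)" for U :: "nat set"
    by (simp add: open_discrete)
qed (auto simp: dist_nat_def)

end

instance nat :: complete_space
proof
  fix X :: "nat \<Rightarrow> nat"
  assume "Cauchy X"
  then obtain M where M: "\<And>m n. m \<ge> M \<Longrightarrow> n \<ge> M \<Longrightarrow> dist (X m) (X n) < 1"
    unfolding Cauchy_def by (metis zero_less_one)
  have "X n = X M" if "n \<ge> M" for n
    using M[OF that order_refl] by (simp add: dist_nat_def)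
  then have "X \<longlonglongrightarrow> X M"
    by (intro tendsto_eventually eventually_sequentiallyI)
  then show "convergent X" by (rule convergentI)
qed

text \<open>Together with the product metric on functions with countable domain, this makes
  \<open>nat \<Rightarrow> nat\<close> a Polish space, so that separation and the covering theorem
  apply to it.\<close>

instance nat :: polish_space ..

section \<open>Closure properties of Suslin sets\<close>

text \<open>In a Polish space these are the analytic sets. Projecting a closed set includes the
  empty set without a special case, and the closure properties reduce to recoding the auxiliary
  sequence.\<close>

definition suslin :: "'z::topological_space set \<Rightarrow> bool" where
  "suslin A \<longleftrightarrow> (\<exists>K :: ('z \<times> (nat \<Rightarrow> nat)) set. closed K \<and> A = fst ` K)"

lemma suslinI:
  fixes K :: "('z::topological_space \<times> (nat \<Rightarrow> nat)) set"
  assumes "closed K" "\<And>z. z \<in> A \<longleftrightarrow> (\<exists>\<alpha>. (z, \<alpha>) \<in> K)"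
  shows "suslin A"
  unfolding suslin_def using assms by (intro exI[of _ K]) force

lemma suslinE:
  fixes A :: "'z::topological_space set"
  assumes "suslin A"
  obtains K :: "('z \<times> (nat \<Rightarrow> nat)) set"
  where "closed K" "\<And>z. z \<in> A \<longleftrightarrow> (\<exists>\<alpha>. (z, \<alpha>) \<in> K)"
proof -
  from assms obtain K :: "('z \<times> (nat \<Rightarrow> nat)) set" where K: "closed K" "A = fst ` K"
    unfolding suslin_def by blast
  show thesis by (rule that[OF K(1)]) (force simp: K(2))
qed

lemma suslin_closed: "closed A \<Longrightarrow> suslin A"
  by (rule suslinI[of "A \<times> UNIV"]) (auto intro: closed_Times)

lemma continuous_on_snd_coord [continuous_intros]:
  "continuous_on S (\<lambda>p::'a::topological_space \<times> ('b \<Rightarrow> 'c::topological_space). snd p i)"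
  using continuous_on_compose2[OF continuous_on_product_coordinates[of i] continuous_on_snd[OF continuous_on_id]]
  by simp

lemma suslin_vimage:
  fixes A :: "'z::topological_space set" and f :: "'w::topological_space \<Rightarrow> 'z"
  assumes "suslin A" "continuous_on UNIV f"
  shows "suslin (f -` A)"
proof -
  obtain K :: "('z \<times> (nat \<Rightarrow> nat)) set"
    where K: "closed K" "\<And>z. z \<in> A \<longleftrightarrow> (\<exists>\<alpha>. (z, \<alpha>) \<in> K)"
    using suslinE[OF assms(1)] by blast
  have "continuous_on UNIV (\<lambda>p::'w \<times> (nat \<Rightarrow> nat). (f (fst p), snd p))"
    by (intro continuous_intros continuous_on_compose2[OF assms(2)]) auto
  from closed_vimage[OF K(1) this] show ?thesis
    by (rule suslinI) (auto simp: K(2))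
qed

text \<open>One auxiliary sequence carries a whole sequence of them: row \<open>n\<close> under
  \<open>prod_encode\<close> witnesses membership in \<open>A n\<close>.\<close>

lemma suslin_INT:
  fixes A :: "nat \<Rightarrow> 'z::topological_space set"
  assumes "\<And>n. suslin (A n)"
  shows "suslin (\<Inter>n. A n)"
proof -
  obtain K :: "nat \<Rightarrow> ('z \<times> (nat \<Rightarrow> nat)) set"
    where K: "\<And>n. closed (K n)" "\<And>n z. z \<in> A n \<longleftrightarrow> (\<exists>\<alpha>. (z, \<alpha>) \<in> K n)"
    using assms unfolding suslin_def by (auto, metis (no_types) fst_conv image_iff prod.collapse)
  let ?f = "\<lambda>n p::'z \<times> (nat \<Rightarrow> nat). (fst p, \<lambda>m. snd p (prod_encode (n, m)))"
  have "closed (?f n -` K n)" for n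
  proof -
    have "continuous_on UNIV (?f n)"
      by (intro continuous_intros)
    then show ?thesis
      by (rule closed_vimage[OF K(1)])
  qed
  then have cl: "closed (\<Inter>n. ?f n -` K n)" by blast
  show ?thesis
  proof (rule suslinI[OF cl])
    fix z
    show "z \<in> (\<Inter>n. A n) \<longleftrightarrow> (\<exists>\<alpha>. (z, \<alpha>) \<in> (\<Inter>n. ?f n -` K n))"
    proof
      assume "z \<in> (\<Inter>n. A n)"
      then have "\<forall>n. \<exists>\<alpha>. (z, \<alpha>) \<in> K n" using K(2) by simp
      then obtain \<alpha> where \<alpha>: "\<And>n. (z, \<alpha> n) \<in> K n" by metis
      show "\<exists>\<alpha>. (z, \<alpha>) \<in> (\<Inter>n. ?f n -` K n)"
        by (rule exI[of _ "\<lambda>k. case prod_decode k of (n, m) \<Rightarrow> \<alpha> n m"]) (use \<alpha> in simp)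
    qed (use K(2) in force)
  qed
qed

text \<open>Entry 0 of the auxiliary sequence names the member of the union, and the tail is the
  witness for it.\<close>

lemma suslin_UN:
  fixes A :: "nat \<Rightarrow> 'z::topological_space set"
  assumes "\<And>n. suslin (A n)"
  shows "suslin (\<Union>n. A n)"
proof -
  obtain K :: "nat \<Rightarrow> ('z \<times> (nat \<Rightarrow> nat)) set"
    where K: "\<And>n. closed (K n)" "\<And>n z. z \<in> A n \<longleftrightarrow> (\<exists>\<alpha>. (z, \<alpha>) \<in> K n)"
    using assms unfolding suslin_def by (auto, metis (no_types) fst_conv image_iff prod.collapse)
  let ?f = "\<lambda>p::'z \<times> (nat \<Rightarrow> nat). (fst p, \<lambda>m. snd p (Suc m))"
  let ?g = "\<lambda>p::'z \<times> (nat \<Rightarrow> nat). snd p 0"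
  have cf: "closed (?f -` C)" if "closed C" for C
  proof -
    have "continuous_on UNIV ?f"
      by (intro continuous_intros)
    then show ?thesis
      by (rule closed_vimage[OF that])
  qed
  have cg: "closed (?g -` C)" for C
  proof -
    have "continuous_on UNIV ?g"
      by (intro continuous_intros)
    then have "open (?g -` (-C))"
      using open_vimage[OF open_discrete] by blast
    then show ?thesis by (simp add: closed_def vimage_Compl)
  qed
  \<comment> \<open>The union over \<open>n\<close> is rewritten as an intersection of implications:
    if entry 0 is \<open>n\<close>, the tail lies in \<open>K n\<close>. Each of them is closed,
    since a condition on one entry is clopen.\<close>
  have cl: "closed (\<Inter>n. ?g -` (-{n}) \<union> ?f -` K n)"
    using K(1) cf cg by (blast intro: closed_Un)
  show ?thesis
  proof (rule suslinI[OF cl])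
    fix z
    show "z \<in> (\<Union>n. A n) \<longleftrightarrow> (\<exists>\<alpha>. (z, \<alpha>) \<in> (\<Inter>n. ?g -` (-{n}) \<union> ?f -` K n))"
    proof
      assume "z \<in> (\<Union>n. A n)"
      then obtain n \<alpha> where \<alpha>: "(z, \<alpha>) \<in> K n" using K(2) by auto
      show "\<exists>\<alpha>. (z, \<alpha>) \<in> (\<Inter>n. ?g -` (-{n}) \<union> ?f -` K n)"
        by (rule exI[of _ "case_nat n \<alpha>"]) (use \<alpha> in simp)
    qed (use K(2) in force)
  qed
qed

lemma suslin_Int:
  assumes "suslin A" "suslin B"
  shows "suslin (A \<inter> B)"
proof -
  have "suslin (\<Inter>n::nat. if n = 0 then A else B)"
    by (rule suslin_INT) (use assms in simp)
  also have "(\<Inter>n::nat. if n = 0 then A else B) = A \<inter> B"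
    by (auto split: if_splits)
  finally show ?thesis .
qed

lemma suslin_finite_INT:
  assumes "finite I" "\<And>i. i \<in> I \<Longrightarrow> suslin (A i)"
  shows "suslin (\<Inter>i\<in>I. A i)"
  using assms
proof (induction I)
  case empty
  then show ?case by (simp add: suslin_closed)
qed (simp add: suslin_Int)

text \<open>The two auxiliary sequences live in one, interleaved as even and odd coordinates.\<close>

lemma suslin_projection:
  fixes B :: "('z::topological_space \<times> (nat \<Rightarrow> nat)) set"
  assumes "suslin B"
  shows "suslin (fst ` B)"
proof -
  obtain K :: "(('z \<times> (nat \<Rightarrow> nat)) \<times> (nat \<Rightarrow> nat)) set"
    where K: "closed K" "\<And>z. z \<in> B \<longleftrightarrow> (\<exists>\<alpha>. (z, \<alpha>) \<in> K)"
    using suslinE[OF assms] by blast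
  let ?f = "\<lambda>p::'z \<times> (nat \<Rightarrow> nat). ((fst p, \<lambda>n. snd p (2 * n)), \<lambda>n. snd p (2 * n + 1))"
  have "continuous_on UNIV ?f"
    by (intro continuous_intros)
  then have cl: "closed (?f -` K)"
    by (rule closed_vimage[OF K(1)])
  show ?thesis
  proof (rule suslinI[OF cl])
    fix z
    show "z \<in> fst ` B \<longleftrightarrow> (\<exists>\<alpha>. (z, \<alpha>) \<in> ?f -` K)"
    proof
      assume "z \<in> fst ` B"
      then obtain y \<alpha> where "((z, y), \<alpha>) \<in> K" using K(2) by force
      then show "\<exists>\<alpha>. (z, \<alpha>) \<in> ?f -` K"
        by (intro exI[of _ "\<lambda>k. if even k then y (k div 2) else \<alpha> (k div 2)"]) simp
    qed (use K(2) in force)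
  qed
qed

text \<open>An open set is the union of the closed sets of points at distance at least
  \<open>1 / (n + 1)\<close> from its complement. The whole space is treated apart:
  \<open>infdist\<close> to the empty set is 0 by convention, which would make that union
  empty.\<close>

lemma suslin_open:
  fixes U :: "'z::metric_space set"
  assumes "open U"
  shows "suslin U"
proof (cases "U = UNIV")
  case False
  have "closed {z. 1 / real (Suc n) \<le> infdist z (- U)}" for n
    by (intro closed_Collect_le continuous_intros)
  then have "suslin (\<Union>n. {z. 1 / real (Suc n) \<le> infdist z (- U)})"
    by (intro suslin_UN suslin_closed)
  moreover have "(\<Union>n. {z. 1 / real (Suc n) \<le> infdist z (- U)}) = U"
  proof (intro equalityI subsetI)
    fix z assume "z \<in> U"
    then have "infdist z (- U) > 0"
      using False assms by (intro infdist_pos_not_in_closed) auto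
    then show "z \<in> (\<Union>n. {z. 1 / real (Suc n) \<le> infdist z (- U)})"
      using nat_approx_posE by (metis (mono_tags, lifting) UN_iff UNIV_I less_eq_real_def mem_Collect_eq)
  next
    fix z assume "z \<in> (\<Union>n. {z. 1 / real (Suc n) \<le> infdist z (- U)})"
    then have "infdist z (- U) \<noteq> 0"
      by (auto simp: divide_simps split: if_splits)
    then show "z \<in> U" using infdist_zero[of z "- U"] by blast
  qed
  ultimately show ?thesis by simp
qed (simp add: suslin_closed)

text \<open>Complements of Suslin sets need not be Suslin, so the induction over the sigma-algebra
  carries the claim for \<open>A\<close> and \<open>- A\<close> together.\<close>

lemma suslin_borel:
  fixes A :: "'z::metric_space set"
  assumes "A \<in> sets borel"
  shows "suslin A"
proof -
  have "A \<in> sigma_sets UNIV {S. open S}"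
    using assms by (simp add: borel_def)
  then have "suslin A \<and> suslin (- A)"
  proof (induction rule: sigma_sets.induct)
    case (Basic a)
    then show ?case by (auto intro: suslin_open suslin_closed)
  next
    case Empty
    then show ?case by (simp add: suslin_closed)
  next
    case (Compl a)
    then show ?case by (simp add: Compl_eq_Diff_UNIV[symmetric])
  next
    case (Union a)
    then show ?case by (auto intro: suslin_UN suslin_INT simp: Compl_UN)
  qed
  then show ?thesis by simp
qed

text \<open>Closed balls around a countable dense set. The diameter bound makes nested pieces shrink
  to a point; the arbitrarily small balls at every point give coverings and, later, the separation
  of two given points.\<close>

lemma countable_small_cballs:
  fixes \<epsilon> :: real
  assumes "\<epsilon> > 0"
  obtains \<B> :: "'w::{metric_space,second_countable_topology} set set"
  where "countable \<B>" "\<And>B. B \<in> \<B> \<Longrightarrow> closed B"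
    "\<And>B x y. B \<in> \<B> \<Longrightarrow> x \<in> B \<Longrightarrow> y \<in> B \<Longrightarrow> dist x y < \<epsilon>"
    "\<And>w \<delta>. \<delta> > 0 \<Longrightarrow> \<exists>B\<in>\<B>. w \<in> B \<and> (\<forall>x\<in>B. dist w x < \<delta>)"
proof -
  obtain D :: "'w set" where D: "countable D" "\<And>X. open X \<Longrightarrow> X \<noteq> {} \<Longrightarrow> \<exists>d\<in>D. d \<in> X"
    using countable_dense_exists by (metis (no_types) )
  define \<B> where "\<B> = (\<lambda>(d, n). cball d (1 / real (Suc n))) ` (D \<times> {n. 2 / real (Suc n) < \<epsilon>})"
  have "countable \<B>"
    unfolding \<B>_def using D(1) by auto
  moreover have "closed B" if "B \<in> \<B>" for B
    using that by (auto simp: \<B>_def)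
  moreover have "dist x y < \<epsilon>" if B0: "B \<in> \<B>" and xy: "x \<in> B" "y \<in> B" for B x y
  proof -
    obtain d n where B: "B = cball d (1 / real (Suc n))" "2 / real (Suc n) < \<epsilon>"
      using B0 unfolding \<B>_def by auto
    have "dist x y \<le> dist d x + dist d y" by (rule dist_triangle3)
    also have "\<dots> \<le> 2 / real (Suc n)" using xy B by auto
    finally show ?thesis using B by simp
  qed
  moreover have "\<exists>B\<in>\<B>. w \<in> B \<and> (\<forall>x\<in>B. dist w x < \<delta>)" if "\<delta> > 0" for w \<delta>
  proof -
    have "min (\<delta> / 2) (\<epsilon> / 2) > 0" using assms that by simp
    from nat_approx_posE[OF this] obtain n where n: "1 / real (Suc n) < min (\<delta> / 2) (\<epsilon> / 2)"
      by blast
    obtain d where d: "d \<in> D" "dist w d < 1 / real (Suc n)"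
      using D(2)[of "ball w (1 / real (Suc n))"] by auto
    have "dist w x < \<delta>" if "x \<in> cball d (1 / real (Suc n))" for x
    proof -
      have "dist w x \<le> dist w d + dist d x" by (rule dist_triangle)
      also have "\<dots> < 1 / real (Suc n) + 1 / real (Suc n)" using d(2) that by auto
      also have "\<dots> < \<delta>" using n by auto
      finally show ?thesis .
    qed
    moreover have "cball d (1 / real (Suc n)) \<in> \<B>"
    proof -
      have "2 / real (Suc n) < \<epsilon>" using n by auto
      then show ?thesis using d(1) by (auto simp: \<B>_def)
    qed
    ultimately show ?thesis
      using d(2) by (intro bexI[of _ "cball d (1 / real (Suc n))"]) (auto simp: dist_commute)
  qed
  ultimately show thesis by (rule that)
qed

section \<open>Separation of disjoint Suslin sets by a Borel set\<close>

definition borel_separable :: "'z::topological_space set \<Rightarrow> 'z set \<Rightarrow> bool" where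
  "borel_separable A B \<longleftrightarrow> (\<exists>C\<in>sets borel. A \<subseteq> C \<and> B \<inter> C = {})"

text \<open>The union over \<open>i\<close> of the intersections over \<open>j\<close> of
  \<open>C i j\<close> separates. Read backwards: if two countable unions cannot be separated,
  neither can some pair of their members.\<close>

lemma borel_separable_UN:
  assumes "countable I" "countable J"
    and "\<And>i j. i \<in> I \<Longrightarrow> j \<in> J \<Longrightarrow> borel_separable (A i) (B j)"
  shows "borel_separable (\<Union>i\<in>I. A i) (\<Union>j\<in>J. B j)"
proof (cases "J = {}")
  case False
  obtain C where C: "\<And>i j. i \<in> I \<Longrightarrow> j \<in> J \<Longrightarrow> C i j \<in> sets borel \<and> A i \<subseteq> C i j \<and> B j \<inter> C i j = {}"
    using assms(3) unfolding borel_separable_def by metis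
  have "(\<Union>i\<in>I. \<Inter>j\<in>J. C i j) \<in> sets borel"
    using assms(1,2) C False by (auto intro!: sets.countable_UN' sets.countable_INT' simp del: INT_simps)
  then show ?thesis
    unfolding borel_separable_def
    by (rule bexI[rotated]) (use C in \<open>intro conjI; fastforce\<close>)
qed (auto simp: borel_separable_def intro!: bexI[of _ UNIV])

text \<open>Inseparability descends to ever smaller closed pieces of the closed sets above
  \<open>A\<close> and \<open>B\<close>. The pieces shrink to points \<open>a\<close> and
  \<open>b\<close> whose projections lie in \<open>A\<close> and \<open>B\<close> and hence differ,
  so a ball around \<open>fst a\<close> separates the projections of late pieces.\<close>

theorem suslin_separation:
  fixes A B :: "'z::polish_space set"
  assumes "suslin A" "suslin B" "A \<inter> B = {}"
  shows "borel_separable A B"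
proof (rule ccontr)
  assume nsep: "\<not> borel_separable A B"
  obtain K :: "('z \<times> (nat \<Rightarrow> nat)) set" where K: "closed K" "A = fst ` K"
    using assms(1) unfolding suslin_def by blast
  obtain L :: "('z \<times> (nat \<Rightarrow> nat)) set" where L: "closed L" "B = fst ` L"
    using assms(2) unfolding suslin_def by blast
  let ?P = "\<lambda>(n::nat) p. closed (fst p) \<and> closed (snd p) \<and> fst p \<subseteq> K \<and> snd p \<subseteq> L
    \<and> \<not> borel_separable (fst ` fst p) (fst ` snd p)"
  let ?Q = "\<lambda>(n::nat) p q. fst q \<subseteq> fst p \<and> snd q \<subseteq> snd p \<and>
    (\<forall>x\<in>fst q. \<forall>y\<in>fst q. dist x y < 1 / real (Suc n)) \<and>
    (\<forall>x\<in>snd q. \<forall>y\<in>snd q. dist x y < 1 / real (Suc n))"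
  have step: "\<exists>q. ?P (Suc n) q \<and> ?Q n p q" if "?P n p" for n p
  proof -
    obtain E F where p: "p = (E, F)" by fastforce
    have EF: "closed E" "closed F" "E \<subseteq> K" "F \<subseteq> L" "\<not> borel_separable (fst ` E) (fst ` F)"
      using that p by auto
    have "1 / real (Suc n) > 0" by simp
    from countable_small_cballs[OF this] obtain \<B> :: "('z \<times> (nat \<Rightarrow> nat)) set set"
      where \<B>: "countable \<B>" "\<And>B. B \<in> \<B> \<Longrightarrow> closed B"
        "\<And>B x y. B \<in> \<B> \<Longrightarrow> x \<in> B \<Longrightarrow> y \<in> B \<Longrightarrow> dist x y < 1 / real (Suc n)"
        "\<And>w \<delta>. \<delta> > 0 \<Longrightarrow> \<exists>B\<in>\<B>. w \<in> B \<and> (\<forall>x\<in>B. dist w x < \<delta>)"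
      by metis
    have cover: "(\<Union>B\<in>\<B>. fst ` (S \<inter> B)) = fst ` S" for S
    proof -
      have "(\<Union>B\<in>\<B>. S \<inter> B) = S" using \<B>(4)[of 1] by fastforce
      then show ?thesis by (metis image_UN)
    qed
    have "\<exists>B\<in>\<B>. \<exists>C\<in>\<B>. \<not> borel_separable (fst ` (E \<inter> B)) (fst ` (F \<inter> C))"
      using borel_separable_UN[OF \<B>(1) \<B>(1), of "\<lambda>B. fst ` (E \<inter> B)" "\<lambda>C. fst ` (F \<inter> C)"]
        EF(5) unfolding cover by blast
    then obtain B C where BC: "B \<in> \<B>" "C \<in> \<B>"
      "\<not> borel_separable (fst ` (E \<inter> B)) (fst ` (F \<inter> C))" by blast
    show ?thesis
      by (rule exI[of _ "(E \<inter> B, F \<inter> C)"])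
        (use EF BC \<B>(2,3) in \<open>auto simp: p intro!: closed_Int\<close>)
  qed
  have "?P 0 (K, L)" using K L nsep by simp
  then have "\<exists>h. \<forall>n. ?P n (h n) \<and> ?Q n (h n) (h (Suc n))"
    by (rule dependent_nat_choice[of ?P ?Q, OF exI step])
  then obtain h where h: "\<forall>n. ?P n (h n) \<and> ?Q n (h n) (h (Suc n))" ..
  define E F where "E n = fst (h n)" and "F n = snd (h n)" for n
  have E: "closed (E n)" "E n \<subseteq> K" and F: "closed (F n)" "F n \<subseteq> L"
    and ns: "\<not> borel_separable (fst ` E n) (fst ` F n)"
    and Edec: "E (Suc n) \<subseteq> E n" and Fdec: "F (Suc n) \<subseteq> F n" for n
    using spec[OF h, of n] by (simp_all add: E_def F_def)
  have Ediam: "dist x y < 1 / real (Suc n)" if "x \<in> E (Suc n)" "y \<in> E (Suc n)" for n x y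
    using spec[OF h, of n] that by (simp add: E_def)
  have Fdiam: "dist x y < 1 / real (Suc n)" if "x \<in> F (Suc n)" "y \<in> F (Suc n)" for n x y
    using spec[OF h, of n] that by (simp add: F_def)
  have ne: "E n \<noteq> {}" "F n \<noteq> {}" for n
    using ns[of n] by (auto simp: borel_separable_def)
  have sm: "\<exists>n. \<forall>x\<in>S n. \<forall>y\<in>S n. dist x y < \<epsilon>"
    if "\<epsilon> > 0" "\<And>n x y. x \<in> S (Suc n) \<Longrightarrow> y \<in> S (Suc n) \<Longrightarrow> dist x y < 1 / real (Suc n)"
    for \<epsilon> and S :: "nat \<Rightarrow> ('z \<times> (nat \<Rightarrow> nat)) set"
    using nat_approx_posE[OF that(1)] that(2) by (meson less_trans)
  obtain a where a: "\<And>n. a \<in> E n"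
    using decreasing_closed_nest[of E, OF E(1) ne(1) lift_Suc_antimono_le[of E, OF Edec]
        sm[of _ E, OF _ Ediam]] by blast
  obtain b where b: "\<And>n. b \<in> F n"
    using decreasing_closed_nest[of F, OF F(1) ne(2) lift_Suc_antimono_le[of F, OF Fdec]
        sm[of _ F, OF _ Fdiam]] by blast
  have "fst a \<noteq> fst b"
    using a[of 0] b[of 0] E(2) F(2) K(2) L(2) assms(3) by blast
  then have pos: "dist (fst a) (fst b) / 2 > 0" by simp
  obtain n where n: "1 / real (Suc n) < dist (fst a) (fst b) / 2"
    using nat_approx_posE[OF pos] by blast
  let ?C = "ball (fst a) (dist (fst a) (fst b) / 2)"
  have "fst ` E (Suc n) \<subseteq> ?C"
  proof clarify
    fix x y assume "(x, y) \<in> E (Suc n)"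
    then have "dist a (x, y) < 1 / real (Suc n)" using Ediam a by blast
    then show "fst (x, y) \<in> ?C"
      using dist_fst_le[of a "(x, y)"] n by simp
  qed
  moreover have "fst ` F (Suc n) \<inter> ?C = {}"
  proof -
    have "z \<notin> ?C" if "(z, y) \<in> F (Suc n)" for z y
    proof -
      have "dist b (z, y) < 1 / real (Suc n)" using Fdiam b that by blast
      then have "dist (fst b) z < dist (fst a) (fst b) / 2"
        using dist_fst_le[of b "(z, y)"] n by simp
      then show ?thesis
        using dist_triangle2[of "fst a" "fst b" z] by (auto simp: dist_commute)
    qed
    then show ?thesis by force
  qed
  ultimately have "borel_separable (fst ` E (Suc n)) (fst ` F (Suc n))"
    unfolding borel_separable_def by (intro bexI[of _ ?C]) auto
  with ns show False by blast
qed

section \<open>Borel sets with countable sections\<close>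

lemma suslin_fst_image:
  fixes K :: "('z::topological_space \<times> (nat \<Rightarrow> nat)) set"
  shows "closed K \<Longrightarrow> suslin (fst ` K)"
  unfolding suslin_def by blast

text \<open>For each \<open>n\<close> and \<open>m\<close>, the arguments whose value has entry
  \<open>m\<close> at place \<open>n\<close> and those whose value has another entry there form
  disjoint Suslin sets, separated by a Borel set \<open>C n m\<close>. On the domain of
  \<open>\<Gamma>\<close>, \<open>y n\<close> is the only \<open>m\<close> with \<open>x\<close> in
  \<open>C n m\<close>; elsewhere whatever \<open>LEAST\<close> returns still depends on
  \<open>x\<close> in a Borel way.\<close>

lemma suslin_function_extends:
  fixes \<Gamma> :: "('z::polish_space \<times> (nat \<Rightarrow> nat)) set"
  assumes "suslin \<Gamma>" and "single_valued \<Gamma>"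
  obtains g where "g \<in> borel_measurable borel" "\<And>x y. (x, y) \<in> \<Gamma> \<Longrightarrow> g x = y"
proof -
  have coord: "closed {p :: 'z \<times> (nat \<Rightarrow> nat). P (snd p n)}" for P n
  proof -
    have "open ((\<lambda>p :: 'z \<times> (nat \<Rightarrow> nat). snd p n) -` {k. \<not> P k})"
      by (intro open_vimage open_discrete continuous_intros)
    then show ?thesis by (simp add: closed_def Collect_neg_eq[symmetric] vimage_def)
  qed
  have "borel_separable (fst ` (\<Gamma> \<inter> {p. snd p n = m})) (fst ` (\<Gamma> \<inter> {p. snd p n \<noteq> m}))" for n m
  proof (rule suslin_separation)
    show "suslin (fst ` (\<Gamma> \<inter> {p. snd p n = m}))" "suslin (fst ` (\<Gamma> \<inter> {p. snd p n \<noteq> m}))"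
      using coord[of "\<lambda>k. k = m" n] coord[of "\<lambda>k. k \<noteq> m" n]
      by (simp_all add: assms(1) suslin_projection suslin_Int suslin_closed)
    show "fst ` (\<Gamma> \<inter> {p. snd p n = m}) \<inter> fst ` (\<Gamma> \<inter> {p. snd p n \<noteq> m}) = {}"
      using assms(2) by (fastforce simp: single_valued_def)
  qed
  then obtain C where C: "\<And>n m. C n m \<in> sets borel"
      "\<And>n m. fst ` (\<Gamma> \<inter> {p. snd p n = m}) \<subseteq> C n m"
      "\<And>n m. fst ` (\<Gamma> \<inter> {p. snd p n \<noteq> m}) \<inter> C n m = {}"
    unfolding borel_separable_def by metis
  define g where "g x n = (LEAST m. x \<in> C n m)" for x n
  have "(\<lambda>x. g x n) \<in> measurable borel (count_space UNIV)" for n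
    unfolding g_def using C(1) by (intro measurable_Least) (simp add: pred_def)
  then have "(\<lambda>x. g x n) \<in> borel_measurable borel" for n
    by (simp add: measurable_cong_sets[OF refl sets_borel_eq_count_space])
  then have "g \<in> borel_measurable borel"
    by (rule measurable_coordinatewise_then_product)
  moreover have "g x = y" if "(x, y) \<in> \<Gamma>" for x y
  proof
    fix n
    have "x \<in> C n (y n)" using C(2)[of n "y n"] that by force
    moreover have "y n \<le> m" if "x \<in> C n m" for m
    proof (rule ccontr)
      assume "\<not> y n \<le> m"
      then have "(x, y) \<in> \<Gamma> \<inter> {p. snd p n \<noteq> m}" using \<open>(x, y) \<in> \<Gamma>\<close> by simp
      then have "x \<in> fst ` (\<Gamma> \<inter> {p. snd p n \<noteq> m})" by force
      then show False using C(3)[of n m] \<open>x \<in> C n m\<close> by blast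
    qed
    ultimately show "g x n = y n"
      unfolding g_def by (rule Least_equality)
  qed
  ultimately show thesis by (rule that)
qed

section \<open>Splitting families of pieces above a common point\<close>

text \<open>
  The ideal of the Cantor-tree argument: a family of pieces is coverable if at every \<open>x\<close> at least
  one of the pieces has its section covered by countably many Borel functions.  The point is that
  non-coverability survives splitting every piece of the family in two, and that a non-coverable
  family has nonempty sections over a common \<open>x\<close>.
\<close>

definition coverable :: "(('z::polish_space \<times> (nat \<Rightarrow> nat)) \<times> (nat \<Rightarrow> nat)) set set \<Rightarrow> bool" where
  "coverable \<E> \<longleftrightarrow> (\<exists>f :: nat \<Rightarrow> 'z \<Rightarrow> (nat \<Rightarrow> nat). (\<forall>n. f n \<in> borel_measurable borel) \<and>
     (\<forall>x. \<exists>E\<in>\<E>. \<forall>y \<alpha>. ((x, y), \<alpha>) \<in> E \<longrightarrow> (\<exists>n. y = f n x)))"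

text \<open>The last clause compares second coordinates alone: branches that part here must end at
  different points of a section, whereas mere disjointness of the pieces could come from the
  auxiliary sequence.\<close>

definition splits :: "real \<Rightarrow> (('z::polish_space \<times> (nat \<Rightarrow> nat)) \<times> (nat \<Rightarrow> nat)) set \<Rightarrow>
    (('z \<times> (nat \<Rightarrow> nat)) \<times> (nat \<Rightarrow> nat)) set \<Rightarrow> (('z \<times> (nat \<Rightarrow> nat)) \<times> (nat \<Rightarrow> nat)) set \<Rightarrow> bool" where
  "splits \<epsilon> E E' E'' \<longleftrightarrow> closed E' \<and> closed E'' \<and> E' \<subseteq> E \<and> E'' \<subseteq> E \<and>
     (\<forall>p\<in>E'. \<forall>q\<in>E'. dist p q < \<epsilon>) \<and> (\<forall>p\<in>E''. \<forall>q\<in>E''. dist p q < \<epsilon>) \<and>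
     (\<forall>p\<in>E'. \<forall>q\<in>E''. snd (fst p) \<noteq> snd (fst q))"

text \<open>Only pairs from a countable family of balls are tried as splittings. If all of them
  fail, the functions covering the resulting families merge into one sequence \<open>F\<close>, and
  a single further function \<open>g\<close> completes it to a cover of the original family.\<close>

lemma not_coverable_split:
  fixes E :: "(('z::polish_space \<times> (nat \<Rightarrow> nat)) \<times> (nat \<Rightarrow> nat)) set"
  assumes nc: "\<not> coverable (insert E \<D>)" and "finite \<D>"
    and cl: "closed E" "\<And>D. D \<in> \<D> \<Longrightarrow> closed D" and "\<epsilon> > 0"
  shows "\<exists>E' E''. splits \<epsilon> E E' E'' \<and> \<not> coverable (insert E' (insert E'' \<D>))"
proof (rule ccontr)
  assume contr: "\<not> ?thesis"
  from countable_small_cballs[OF \<open>\<epsilon> > 0\<close>]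
  obtain \<B> :: "(('z \<times> (nat \<Rightarrow> nat)) \<times> (nat \<Rightarrow> nat)) set set"
    where \<B>: "countable \<B>" "\<And>B. B \<in> \<B> \<Longrightarrow> closed B"
      "\<And>B x y. B \<in> \<B> \<Longrightarrow> x \<in> B \<Longrightarrow> y \<in> B \<Longrightarrow> dist x y < \<epsilon>"
      "\<And>w \<delta>. \<delta> > 0 \<Longrightarrow> \<exists>B\<in>\<B>. w \<in> B \<and> (\<forall>x\<in>B. dist w x < \<delta>)"
    by metis
  define \<C> where "\<C> = {(B, B'). B \<in> \<B> \<and> B' \<in> \<B> \<and> (\<forall>p\<in>B. \<forall>q\<in>B'. snd (fst p) \<noteq> snd (fst q))}"
  have "countable \<C>"
    by (rule countable_subset[of _ "\<B> \<times> \<B>"]) (use \<B>(1) in \<open>auto simp: \<C>_def\<close>)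
  have "splits \<epsilon> E (E \<inter> fst c) (E \<inter> snd c)" if "c \<in> \<C>" for c
    using that \<B>(2,3) cl(1) by (fastforce simp: splits_def \<C>_def)
  then have cov: "coverable (insert (E \<inter> fst c) (insert (E \<inter> snd c) \<D>))" if "c \<in> \<C>" for c
    using contr that by blast
  have "\<exists>f :: nat \<Rightarrow> 'z \<Rightarrow> (nat \<Rightarrow> nat). (\<forall>n. f n \<in> borel_measurable borel) \<and>
     (c \<in> \<C> \<longrightarrow> (\<forall>x. \<exists>D\<in>insert (E \<inter> fst c) (insert (E \<inter> snd c) \<D>).
        \<forall>y \<alpha>. ((x, y), \<alpha>) \<in> D \<longrightarrow> (\<exists>n. y = f n x)))" for c
  proof (cases "c \<in> \<C>")
    case True
    then show ?thesis using cov[OF True] by (simp only: coverable_def simp_thms)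
  qed (auto intro!: exI[of _ "\<lambda>_ _. undefined"])
  then have "\<forall>c. \<exists>f :: nat \<Rightarrow> 'z \<Rightarrow> (nat \<Rightarrow> nat). (\<forall>n. f n \<in> borel_measurable borel) \<and>
     (c \<in> \<C> \<longrightarrow> (\<forall>x. \<exists>D\<in>insert (E \<inter> fst c) (insert (E \<inter> snd c) \<D>).
        \<forall>y \<alpha>. ((x, y), \<alpha>) \<in> D \<longrightarrow> (\<exists>n. y = f n x)))" ..
  from choice[OF this] obtain f :: "_ \<Rightarrow> nat \<Rightarrow> 'z \<Rightarrow> (nat \<Rightarrow> nat)" where
    f0: "\<forall>c. (\<forall>n. f c n \<in> borel_measurable borel) \<and>
     (c \<in> \<C> \<longrightarrow> (\<forall>x. \<exists>D\<in>insert (E \<inter> fst c) (insert (E \<inter> snd c) \<D>).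
        \<forall>y \<alpha>. ((x, y), \<alpha>) \<in> D \<longrightarrow> (\<exists>n. y = f c n x)))" ..
  have f: "f c n \<in> borel_measurable borel"
    "c \<in> \<C> \<Longrightarrow> \<exists>D\<in>insert (E \<inter> fst c) (insert (E \<inter> snd c) \<D>).
        \<forall>y \<alpha>. ((x, y), \<alpha>) \<in> D \<longrightarrow> (\<exists>n. y = f c n x)" for c n x
    using spec[OF f0, of c] by (simp_all only: simp_thms)
  \<comment> \<open>If \<open>\<C>\<close> is empty, \<open>from_nat_into\<close> returns an
    arbitrary pair; this is harmless because \<open>f c n\<close> is Borel for every
    \<open>c\<close>.\<close>
  define F where "F k = f (from_nat_into \<C> (fst (prod_decode k))) (snd (prod_decode k))" for k
  have F: "F k \<in> borel_measurable borel" for k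
    unfolding F_def by (rule f(1))
  have F_covers: "\<exists>k. f c n x = F k x" if "c \<in> \<C>" for c n x
  proof -
    obtain i where "from_nat_into \<C> i = c"
      using from_nat_into_surj[OF \<open>countable \<C>\<close> \<open>c \<in> \<C>\<close>] by blast
    then have "f c n = F (prod_encode (i, n))" by (simp add: F_def)
    then show ?thesis by metis
  qed
  define N where "N = {p :: 'z \<times> (nat \<Rightarrow> nat). \<forall>k. snd p \<noteq> F k (fst p)}"
  have "{p :: 'z \<times> (nat \<Rightarrow> nat). snd p = F k (fst p)} \<in> sets borel" for k
  proof -
    have "(\<lambda>p :: 'z \<times> (nat \<Rightarrow> nat). F k (fst p)) \<in> borel_measurable borel"
      by (rule measurable_compose[OF _ F]) (intro borel_measurable_continuous_onI continuous_intros)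
    moreover have "(snd :: 'z \<times> (nat \<Rightarrow> nat) \<Rightarrow> _) \<in> borel_measurable borel"
      by (intro borel_measurable_continuous_onI continuous_intros)
    ultimately show ?thesis
      using measurable_equality_set[of snd borel "\<lambda>p :: 'z \<times> (nat \<Rightarrow> nat). F k (fst p)"] by simp
  qed
  then have "(\<Inter>k. - {p :: 'z \<times> (nat \<Rightarrow> nat). snd p = F k (fst p)}) \<in> sets borel"
    by (intro sets.countable_INT) auto
  also have "(\<Inter>k. - {p :: 'z \<times> (nat \<Rightarrow> nat). snd p = F k (fst p)}) = N"
    by (auto simp: N_def)
  finally have "suslin N" by (rule suslin_borel)
  \<comment> \<open>\<open>A D\<close> collects the points over which \<open>D\<close> still has a
    point on none of the graphs of the \<open>F k\<close>.\<close>
  define A where "A D = fst ` (fst ` D \<inter> N)" for D :: "(('z \<times> (nat \<Rightarrow> nat)) \<times> (nat \<Rightarrow> nat)) set"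
  \<comment> \<open>Points over which the pieces of \<open>\<D>\<close> are not exhausted by the \<open>F k\<close>; two of them on one
    vertical line would be separated by some pair in \<open>\<C>\<close>, so this is the graph of a function.\<close>
  define \<Gamma> where "\<Gamma> = fst ` E \<inter> N \<inter> (\<Inter>D\<in>\<D>. fst -` A D)"
  have "suslin (fst -` A D :: ('z \<times> (nat \<Rightarrow> nat)) set)" if "D \<in> \<D>" for D
  proof -
    have "suslin (A D)"
      unfolding A_def using cl(2)[OF that] \<open>suslin N\<close>
      by (intro suslin_projection suslin_Int suslin_fst_image)
    then show ?thesis by (intro suslin_vimage continuous_intros)
  qed
  moreover have "suslin (fst ` E)" using cl(1) by (rule suslin_fst_image)
  ultimately have "suslin \<Gamma>"
    unfolding \<Gamma>_def using \<open>suslin N\<close> \<open>finite \<D>\<close>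
    by (intro suslin_Int suslin_finite_INT) auto
  moreover have "single_valued \<Gamma>"
  proof (rule single_valuedI, rule ccontr)
    fix x y y'
    assume xy: "(x, y) \<in> \<Gamma>" "(x, y') \<in> \<Gamma>" and "y \<noteq> y'"
    then obtain \<alpha> \<alpha>' where \<alpha>: "((x, y), \<alpha>) \<in> E" "((x, y'), \<alpha>') \<in> E"
      by (auto simp: \<Gamma>_def)
    \<comment> \<open>Balls of radius half this distance around the two triples share no second
      coordinate, since the product distance dominates the distance of second coordinates.\<close>
    have pos: "dist y y' / 2 > 0" using \<open>y \<noteq> y'\<close> by simp
    obtain B where B: "B \<in> \<B>" "((x, y), \<alpha>) \<in> B" "\<And>p. p \<in> B \<Longrightarrow> dist ((x, y), \<alpha>) p < dist y y' / 2"
      using \<B>(4)[OF pos] by metis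
    obtain B' where B': "B' \<in> \<B>" "((x, y'), \<alpha>') \<in> B'" "\<And>p. p \<in> B' \<Longrightarrow> dist ((x, y'), \<alpha>') p < dist y y' / 2"
      using \<B>(4)[OF pos] by metis
    have near: "dist v (snd (fst q)) \<le> dist ((x, v), \<beta>) q"
      for v \<beta> and q :: "('z \<times> (nat \<Rightarrow> nat)) \<times> (nat \<Rightarrow> nat)"
      using dist_snd_le[of "(x, v)" "fst q"] dist_fst_le[of "((x, v), \<beta>)" q] by simp
    have "snd (fst p) \<noteq> snd (fst q)" if "p \<in> B" "q \<in> B'" for p q
    proof
      assume "snd (fst p) = snd (fst q)"
      then show False
        using near[of y p \<alpha>] near[of y' q \<alpha>'] B(3)[OF that(1)] B'(3)[OF that(2)]
          dist_triangle2[of y y' "snd (fst q)"] by simp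
    qed
    then have c: "(B, B') \<in> \<C>" using B(1) B'(1) by (simp add: \<C>_def)
    obtain D where D: "D \<in> insert (E \<inter> B) (insert (E \<inter> B') \<D>)"
        "\<forall>y \<alpha>. ((x, y), \<alpha>) \<in> D \<longrightarrow> (\<exists>n. y = f (B, B') n x)"
      using f(2)[OF c, of x] unfolding fst_conv snd_conv by (rule bexE)
    have DF: "(x, v) \<notin> N" if vD: "((x, v), \<beta>) \<in> D" for v \<beta>
    proof -
      obtain n where "v = f (B, B') n x" using D(2) vD by blast
      then show ?thesis using F_covers[OF c, of n x] by (auto simp: N_def)
    qed
    consider "D = E \<inter> B" | "D = E \<inter> B'" | "D \<in> \<D>" using D(1) by blast
    then show False
    proof cases
      case 1 then show False using DF \<alpha>(1) B(2) xy(1) by (auto simp: \<Gamma>_def)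
    next
      case 2 then show False using DF \<alpha>(2) B'(2) xy(2) by (auto simp: \<Gamma>_def)
    next
      case 3 then show False using DF xy(1) by (auto simp: \<Gamma>_def A_def)
    qed
  qed
  ultimately obtain g where g: "g \<in> borel_measurable borel" "\<And>x y. (x, y) \<in> \<Gamma> \<Longrightarrow> g x = y"
    using suslin_function_extends by blast
  define f' where "f' = case_nat g F"
  have f'_g: "f' 0 = g" and f'_F: "\<And>k. f' (Suc k) = F k" by (simp_all add: f'_def)
  have "\<forall>n. f' n \<in> borel_measurable borel"
    using g(1) F f'_g f'_F by (metis not0_implies_Suc)
  moreover have "\<exists>D\<in>insert E \<D>. \<forall>y \<alpha>. ((x, y), \<alpha>) \<in> D \<longrightarrow> (\<exists>n. y = f' n x)" for x
  \<comment> \<open>Either some \<open>D\<close> is exhausted by \<open>F\<close> over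
    \<open>x\<close> and serves as the covered member, or every point of \<open>E\<close> over
    \<open>x\<close> that \<open>F\<close> misses lies on \<open>\<Gamma>\<close> and is the value
    of \<open>g\<close>.\<close>
  proof (cases "\<forall>D\<in>\<D>. x \<in> A D")
    case True
    have "\<exists>n. y = f' n x" if "((x, y), \<alpha>) \<in> E" for y \<alpha>
    proof (cases "(x, y) \<in> N")
      case True
      then have "(x, y) \<in> \<Gamma>"
        using that \<open>\<forall>D\<in>\<D>. x \<in> A D\<close> by (force simp: \<Gamma>_def)
      then show ?thesis using g(2) f'_g by metis
    next
      case False
      then obtain k where "y = F k x" by (auto simp: N_def)
      then show ?thesis using f'_F[of k] by metis
    qed
    then show ?thesis by blast
  next
    case False
    then obtain D where "D \<in> \<D>" "x \<notin> A D" by blast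
    have "\<exists>n. y = f' n x" if xyD: "((x, y), \<alpha>) \<in> D" for y \<alpha>
    proof -
      have "(x, y) \<notin> N" using \<open>x \<notin> A D\<close> xyD by (force simp: A_def)
      then obtain k where "y = F k x" by (auto simp: N_def)
      then show ?thesis using f'_F[of k] by metis
    qed
    then show ?thesis using \<open>D \<in> \<D>\<close> by blast
  qed
  ultimately have "coverable (insert E \<D>)"
    unfolding coverable_def by blast
  with nc show False ..
qed

text \<open>The pieces are split one at a time; the two halves of a piece already split are moved
  into \<open>\<D>\<close>, which is why the induction generalises over it.\<close>

lemma not_coverable_split_all:
  fixes E :: "'i \<Rightarrow> (('z::polish_space \<times> (nat \<Rightarrow> nat)) \<times> (nat \<Rightarrow> nat)) set"
  assumes "finite I" "\<epsilon> > 0" "finite \<D>" "\<And>D. D \<in> \<D> \<Longrightarrow> closed D" "\<And>i. i \<in> I \<Longrightarrow> closed (E i)"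
    and "\<not> coverable (E ` I \<union> \<D>)"
  shows "\<exists>E' E''. (\<forall>i\<in>I. splits \<epsilon> (E i) (E' i) (E'' i)) \<and> \<not> coverable (E' ` I \<union> E'' ` I \<union> \<D>)"
  using assms(1,3-)
proof (induction I arbitrary: \<D>)
  case empty
  then show ?case by auto
next
  case (insert j I)
  have "\<not> coverable (insert (E j) (E ` I \<union> \<D>))" using insert.prems by simp
  then obtain A B where AB: "splits \<epsilon> (E j) A B" "\<not> coverable (insert A (insert B (E ` I \<union> \<D>)))"
    using not_coverable_split[of "E j" "E ` I \<union> \<D>" \<epsilon>] insert.prems insert.hyps assms(2) by blast
  have "\<not> coverable (E ` I \<union> insert A (insert B \<D>))" using AB(2) by simp
  then obtain E' E'' where E: "\<forall>i\<in>I. splits \<epsilon> (E i) (E' i) (E'' i)"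
      "\<not> coverable (E' ` I \<union> E'' ` I \<union> insert A (insert B \<D>))"
  proof -
    have "\<exists>E' E''. (\<forall>i\<in>I. splits \<epsilon> (E i) (E' i) (E'' i))
        \<and> \<not> coverable (E' ` I \<union> E'' ` I \<union> insert A (insert B \<D>))"
      by (rule insert.IH) (use insert.prems AB in \<open>auto simp: splits_def\<close>)
    then show thesis using that by blast
  qed
  have "(E'(j := A)) ` insert j I \<union> (E''(j := B)) ` insert j I \<union> \<D> = E' ` I \<union> E'' ` I \<union> insert A (insert B \<D>)"
    using insert.hyps by auto
  then show ?case
    using E AB(1) insert.hyps
    by (intro exI[of _ "E'(j := A)"] exI[of _ "E''(j := B)"]) auto
qed

text \<open>If over every \<open>x\<close> some piece had an empty section, any constant functions
  would cover the family.\<close>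

lemma not_coverable_common_point:
  fixes \<E> :: "(('z::polish_space \<times> (nat \<Rightarrow> nat)) \<times> (nat \<Rightarrow> nat)) set set"
  assumes "\<not> coverable \<E>"
  obtains x where "\<And>E. E \<in> \<E> \<Longrightarrow> \<exists>y \<alpha>. ((x, y), \<alpha>) \<in> E"
proof -
  have "\<exists>x. \<forall>E\<in>\<E>. \<exists>y \<alpha>. ((x, y), \<alpha>) \<in> E"
  proof (rule ccontr)
    assume empty: "\<not> ?thesis"
    have "coverable \<E>"
      unfolding coverable_def
    proof (rule exI[of _ "\<lambda>_ _. undefined"], intro conjI allI)
      show "\<exists>E\<in>\<E>. \<forall>y \<alpha>. ((x, y), \<alpha>) \<in> E \<longrightarrow> (\<exists>n::nat. y = undefined)" for x
      proof -
        obtain E where "E \<in> \<E>" "\<nexists>y \<alpha>. ((x, y), \<alpha>) \<in> E" using empty by meson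
        then show ?thesis by (intro bexI[of _ E]) auto
      qed
    qed (rule borel_measurable_const)
    with assms show False ..
  qed
  then obtain x where "\<forall>E\<in>\<E>. \<exists>y \<alpha>. ((x, y), \<alpha>) \<in> E" ..
  then show thesis by (intro that[of x]) (rule bspec)
qed

lemma uncountable_UNIV_nat_bool: "uncountable (UNIV :: (nat \<Rightarrow> bool) set)"
proof
  assume ctb: "countable (UNIV :: (nat \<Rightarrow> bool) set)"
  define d where "d = (\<lambda>n. \<not> from_nat_into (UNIV :: (nat \<Rightarrow> bool) set) n n)"
  obtain k where "from_nat_into UNIV k = d"
    using from_nat_into_surj[OF ctb UNIV_I[of d]] by (rule exE)
  then have "from_nat_into UNIV k k = d k" by (rule fun_cong)
  then show False by (simp only: d_def simp_thms)
qed

section \<open>Covering a Suslin set with countable sections by Borel functions\<close>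

text \<open>The common point found at one level of the tree of splittings need not be the one found
  at the next. It is the shrinking diameters that put the limit points of all branches over the same
  first coordinate.\<close>

theorem lusin_novikov:
  fixes P :: "('z::polish_space \<times> (nat \<Rightarrow> nat)) set"
  assumes "suslin P" and ctb: "\<And>x. countable (P `` {x})"
  obtains f :: "nat \<Rightarrow> 'z \<Rightarrow> (nat \<Rightarrow> nat)"
  where "\<And>n. f n \<in> borel_measurable borel" "\<And>x y. (x, y) \<in> P \<Longrightarrow> \<exists>n. y = f n x"
proof -
  obtain K :: "(('z \<times> (nat \<Rightarrow> nat)) \<times> (nat \<Rightarrow> nat)) set" where K: "closed K" "P = fst ` K"
    using assms(1) unfolding suslin_def by blast
  have "coverable {K}"
  proof (rule ccontr)
    assume nc: "\<not> coverable {K}"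
    let ?I = "\<lambda>n. {s :: bool list. length s = n}"
    let ?P = "\<lambda>n H. (\<forall>s\<in>?I n. closed (H s) \<and> H s \<subseteq> K) \<and> \<not> coverable (H ` ?I n)"
    let ?Q = "\<lambda>n H H'. \<forall>s\<in>?I n. splits (1 / real (Suc n)) (H s) (H' (True # s)) (H' (False # s))"
    have step: "\<exists>H'. ?P (Suc n) H' \<and> ?Q n H H'" if H: "?P n H" for n H
    proof -
      have fin: "finite (?I n)"
        using finite_lists_length_eq[of "UNIV :: bool set" n] by simp
      have "\<exists>E' E''. (\<forall>s\<in>?I n. splits (1 / real (Suc n)) (H s) (E' s) (E'' s))
          \<and> \<not> coverable (E' ` ?I n \<union> E'' ` ?I n \<union> {})"
        by (rule not_coverable_split_all[OF fin]) (use H in auto)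
      then obtain E' E'' where E: "\<forall>s\<in>?I n. splits (1 / real (Suc n)) (H s) (E' s) (E'' s)"
          "\<not> coverable (E' ` ?I n \<union> E'' ` ?I n)" by auto
      define H' where "H' t = (if hd t then E' (tl t) else E'' (tl t))" for t
      have H'_Cons: "H' (True # s) = E' s" "H' (False # s) = E'' s" for s
        by (simp_all add: H'_def)
      have "H' ` ?I (Suc n) = E' ` ?I n \<union> E'' ` ?I n"
      proof -
        have "?I (Suc n) = Cons True ` ?I n \<union> Cons False ` ?I n"
          by (auto simp: length_Suc_conv image_iff)
        moreover have "H' ` Cons True ` J = E' ` J" "H' ` Cons False ` J = E'' ` J" for J
          by (simp_all add: image_image H'_Cons)
        ultimately show ?thesis by (simp only: image_Un)
      qed
      moreover have "closed (H' t) \<and> H' t \<subseteq> K" if t_len: "t \<in> ?I (Suc n)" for t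
      proof -
        obtain c s where t: "t = c # s" "s \<in> ?I n" using t_len by (cases t) auto
        have "closed (E' s)" "E' s \<subseteq> H s" "closed (E'' s)" "E'' s \<subseteq> H s" "H s \<subseteq> K"
          using bspec[OF E(1) t(2)] H t(2) by (auto simp only: splits_def)
        then show ?thesis by (cases c) (auto simp: t(1) H'_Cons)
      qed
      ultimately have "?P (Suc n) H'" using E(2) by simp
      moreover have "?Q n H H'" using E(1) by (simp add: H'_def)
      ultimately show ?thesis by blast
    qed
    have "?P 0 (\<lambda>_. K)" using K(1) nc by simp
    then have "\<exists>h. \<forall>n. ?P n (h n) \<and> ?Q n (h n) (h (Suc n))"
      by (rule dependent_nat_choice[of ?P ?Q, OF exI step])
    then obtain h where h: "\<forall>n. ?P n (h n) \<and> ?Q n (h n) (h (Suc n))" ..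
    have h_closed: "closed (h n s)" and h_sub: "h n s \<subseteq> K"
      and h_split: "splits (1 / real (Suc n)) (h n s) (h (Suc n) (True # s)) (h (Suc n) (False # s))"
      if "length s = n" for n s
      using spec[OF h, of n] that by auto
    have h_nc: "\<not> coverable (h n ` ?I n)" for n
      using spec[OF h, of n] by blast
    have h_next: "h (Suc n) (c # s) \<subseteq> h n s"
        "p \<in> h (Suc n) (c # s) \<Longrightarrow> q \<in> h (Suc n) (c # s) \<Longrightarrow> dist p q < 1 / real (Suc n)"
      if "length s = n" for n s c p q
      using h_split[OF that] by (cases c; auto simp: splits_def)+
    \<comment> \<open>A node at level \<open>n\<close> is a list of \<open>n\<close> choices with
      the latest one at the head, hence \<open>rev\<close>.\<close>
    define S where "S b n = h n (rev (map b [0..<n]))" for b n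
    have S_Suc: "S b (Suc n) = h (Suc n) (b n # rev (map b [0..<n]))" for b n
      by (simp add: S_def)
    have S_dec: "S b (Suc n) \<subseteq> S b n" for b n
      unfolding S_Suc unfolding S_def by (rule h_next) simp
    have S_small: "dist p q < 1 / real (Suc n)" if "p \<in> S b (Suc n)" "q \<in> S b (Suc n)" for b n p q
      using that unfolding S_Suc by (rule h_next(2)[rotated]) simp
    have "\<exists>x. \<forall>b. \<exists>y \<alpha>. ((x, y), \<alpha>) \<in> S b n" for n
    proof -
      obtain x where x: "E \<in> h n ` ?I n \<Longrightarrow> \<exists>y \<alpha>. ((x, y), \<alpha>) \<in> E" for E
        using not_coverable_common_point[OF h_nc[of n]] by blast
      have "S b n \<in> h n ` ?I n" for b
        unfolding S_def by (rule imageI) simp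
      then show ?thesis by (intro exI[of _ x] allI x)
    qed
    then have "\<forall>n. \<exists>x. \<forall>b. \<exists>y \<alpha>. ((x, y), \<alpha>) \<in> S b n" ..
    from choice[OF this] obtain x where x0: "\<forall>n b. \<exists>y \<alpha>. ((x n, y), \<alpha>) \<in> S b n" ..
    then have x: "\<exists>y \<alpha>. ((x n, y), \<alpha>) \<in> S b n" for b n by blast
    have "\<exists>p. \<forall>n. p \<in> S b n" for b
    proof -
      have "closed (S b n)" for n
        unfolding S_def by (rule h_closed) simp
      moreover have "S b n \<noteq> {}" for n
        using x[of n b] by blast
      moreover have "\<exists>n. \<forall>p\<in>S b n. \<forall>q\<in>S b n. dist p q < \<epsilon>" if "\<epsilon> > 0" for \<epsilon>
      proof -
        obtain n where "1 / real (Suc n) < \<epsilon>" using nat_approx_posE[OF \<open>\<epsilon> > 0\<close>] by blast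
        then show ?thesis using S_small[of _ b n] by (meson less_trans)
      qed
      ultimately show ?thesis
        using decreasing_closed_nest[of "S b", OF _ _ lift_Suc_antimono_le[of "S b", OF S_dec]] by blast
    qed
    then obtain p where p: "\<And>b n. p b \<in> S b n" by metis
    have near: "dist (fst (fst (p b))) (x (Suc n)) < 1 / real (Suc n)" for b n
    proof -
      obtain y \<alpha> where q: "((x (Suc n), y), \<alpha>) \<in> S b (Suc n)" using x by blast
      have "dist (fst (fst (p b))) (x (Suc n)) \<le> dist (p b) ((x (Suc n), y), \<alpha>)"
        using dist_fst_le[of "fst (p b)" "(x (Suc n), y)"] dist_fst_le[of "p b" "((x (Suc n), y), \<alpha>)"]
        by simp
      also have "\<dots> < 1 / real (Suc n)" using p q by (rule S_small)
      finally show ?thesis .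
    qed
    have same: "fst (fst (p b)) = fst (fst (p b'))" for b b'
    proof (rule ccontr)
      assume "fst (fst (p b)) \<noteq> fst (fst (p b'))"
      then have "dist (fst (fst (p b))) (fst (fst (p b'))) / 2 > 0" by simp
      from nat_approx_posE[OF this] obtain n
        where "1 / real (Suc n) < dist (fst (fst (p b))) (fst (fst (p b'))) / 2" by blast
      then show False
        using near[of b n] near[of b' n]
          dist_triangle2[of "fst (fst (p b))" "fst (fst (p b'))" "x (Suc n)"] by simp
    qed
    have "inj (\<lambda>b. snd (fst (p b)))"
    proof (rule injI, rule ccontr)
      fix b b' :: "nat \<Rightarrow> bool"
      assume eq: "snd (fst (p b)) = snd (fst (p b'))" and "b \<noteq> b'"
      then have "\<exists>n. b n \<noteq> b' n" by blast
      \<comment> \<open>At the first disagreement the two branches leave the same piece for its two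
        halves, which have no second coordinate in common.\<close>
      define n where "n = (LEAST n. b n \<noteq> b' n)"
      have n: "b n \<noteq> b' n" "m < n \<Longrightarrow> b m = b' m" for m
        unfolding n_def using LeastI_ex[OF \<open>\<exists>n. b n \<noteq> b' n\<close>] not_less_Least by blast+
      define s where "s = rev (map b [0..<n])"
      have s': "s = rev (map b' [0..<n])" using n(2) by (simp add: s_def)
      have pb: "p b \<in> h (Suc n) (b n # s)" "p b' \<in> h (Suc n) (b' n # s)"
        using p[of b "Suc n"] p[of b' "Suc n"] unfolding S_Suc s_def[symmetric] s'[symmetric]
        by blast+
      have "splits (1 / real (Suc n)) (h n s) (h (Suc n) (True # s)) (h (Suc n) (False # s))"
        by (rule h_split) (simp add: s_def)
      then have sep: "snd (fst u) \<noteq> snd (fst v)"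
        if "u \<in> h (Suc n) (True # s)" "v \<in> h (Suc n) (False # s)" for u v
        using that unfolding splits_def by blast
      show False
        using n(1) eq pb sep[of "p b" "p b'"] sep[of "p b'" "p b"] by (cases "b n") auto
    qed
    moreover have "range (\<lambda>b. snd (fst (p b))) \<subseteq> P `` {fst (fst (p (\<lambda>_. True)))}"
    proof (rule image_subsetI)
      fix b
      have "p b \<in> K" using p[of b 0] h_sub[of "[]" 0] by (auto simp: S_def)
      then have "(fst (fst (p b)), snd (fst (p b))) \<in> P" by (simp add: K(2))
      then show "snd (fst (p b)) \<in> P `` {fst (fst (p (\<lambda>_. True)))}"
        using same[of b "\<lambda>_. True"] by simp
    qed
    ultimately show False
      using uncountable_UNIV_nat_bool countable_subset[OF _ ctb] countable_image_inj_on by blast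
  qed
  then obtain f :: "nat \<Rightarrow> 'z \<Rightarrow> (nat \<Rightarrow> nat)" where f: "\<forall>n. f n \<in> borel_measurable borel"
    "\<forall>x. \<exists>E\<in>{K}. \<forall>y \<alpha>. ((x, y), \<alpha>) \<in> E \<longrightarrow> (\<exists>n. y = f n x)"
    unfolding coverable_def by blast
  show thesis
  proof (rule that[of f])
    show "\<exists>n. y = f n x" if xy: "(x, y) \<in> P" for x y
    proof -
      obtain \<alpha> where "((x, y), \<alpha>) \<in> K" using xy K(2) by auto
      then show ?thesis using spec[OF f(2), of x] by fast
    qed
  qed (use f(1) in blast)
qed

section \<open>Transfer to standard Borel spaces\<close>

text \<open>A point is coded by the indices of dense points within \<open>r k\<close> of it, and
  decoding takes the limit. \<open>K\<close> is the set of consistent codes, on which completeness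
  supplies the limit; off \<open>K\<close> the decoding is constant. A point may have many codes,
  and \<open>e\<close> selects one.\<close>

lemma standard_borel_retract_of_baire:
  assumes "standard_borel_space X" "space X \<noteq> {}"
  obtains e :: "'a \<Rightarrow> (nat \<Rightarrow> nat)" and L :: "(nat \<Rightarrow> nat) \<Rightarrow> 'a"
  where "e \<in> X \<rightarrow>\<^sub>M borel" "L \<in> borel \<rightarrow>\<^sub>M X" "\<And>x. x \<in> space X \<Longrightarrow> L (e x) = x"
proof -
  obtain T where T: "completely_metrizable_space T" "separable_space T" "topspace T = space X"
      "sets X = sigma_sets (space X) {U. openin T U}"
    using assms(1) unfolding standard_borel_space_def polish_topology_def by blast
  obtain M d where Md: "Metric_space M d" "Metric_space.mcomplete M d" "T = Metric_space.mtopology M d"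
    using T(1) unfolding completely_metrizable_space_def by blast
  interpret Metric_space M d by (rule Md(1))
  have M: "M = space X" using T(3) Md(3) topspace_mtopology by simp
  obtain C where C: "countable C" "C \<subseteq> M" "mtopology closure_of C = M"
    using T(2) topspace_mtopology unfolding separable_space_def Md(3) by auto
  have "C \<noteq> {}" using C(3) assms(2) M by force
  define c where "c = from_nat_into C"
  have cM: "c n \<in> M" for n
    using from_nat_into[OF \<open>C \<noteq> {}\<close>] C(2) unfolding c_def by blast
  have dense: "\<exists>n. d x (c n) < r" if xM: "x \<in> M" and r0: "r > 0" for x r
  proof -
    have "x \<in> mtopology closure_of C" using xM C(3) by blast
    then obtain y where y: "y \<in> C" "y \<in> mball x r"
      using r0 unfolding metric_closure_of by blast
    obtain n where "c n = y" using from_nat_into_surj[OF C(1) y(1)] unfolding c_def by blast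
    then show ?thesis using y(2) by auto
  qed
  define r where "r k = 1 / real (Suc k)" for k
  have r_pos: "r k > 0" for k by (simp add: r_def)
  have r_small: "\<exists>k. r k < \<epsilon>" if \<epsilon>: "\<epsilon> > 0" for \<epsilon>
    using nat_approx_posE[OF \<epsilon>] unfolding r_def by blast
  have r_mono: "r l \<le> r k" if "k \<le> l" for k l
    using that by (simp add: r_def field_simps)
  define e where "e x k = (LEAST n. d x (c n) < r k)" for x k
  have e: "d x (c (e x k)) < r k" if "x \<in> M" for x k
    unfolding e_def using dense[OF that r_pos] by (rule LeastI_ex)
  \<comment> \<open>This bound is what the triangle inequality through a common limit yields, so
    every code \<open>e x\<close> satisfies it; conversely it makes \<open>c (u k)\<close> a Cauchy
    sequence. Each condition involves two entries only, which makes \<open>K\<close> Borel.\<close>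
  define K where "K = {u :: nat \<Rightarrow> nat. \<forall>k l. d (c (u k)) (c (u l)) \<le> r k + r l}"
  define lim where "lim u x \<longleftrightarrow> x \<in> M \<and> (\<forall>k. d x (c (u k)) \<le> r k)" for u x
  have lim_ex: "\<exists>x. lim u x" if u: "u \<in> K" for u
  proof -
    have "MCauchy (\<lambda>k. c (u k))"
      unfolding MCauchy_def
    proof (intro conjI allI impI)
      fix \<epsilon> :: real assume "\<epsilon> > 0"
      then obtain N where N: "r N < \<epsilon> / 2" using r_small[of "\<epsilon> / 2"] by auto
      have "d (c (u n)) (c (u n')) < \<epsilon>" if nn: "N \<le> n" "N \<le> n'" for n n'
      proof -
        have "d (c (u n)) (c (u n')) \<le> r n + r n'" using u by (simp add: K_def)
        then show ?thesis using r_mono[OF nn(1)] r_mono[OF nn(2)] N by simp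
      qed
      then show "\<exists>N. \<forall>n n'. N \<le> n \<longrightarrow> N \<le> n' \<longrightarrow> d (c (u n)) (c (u n')) < \<epsilon>" by blast
    qed (use cM in blast)
    then obtain x where "limitin mtopology (\<lambda>k. c (u k)) x sequentially"
      using Md(2) unfolding mcomplete_def by blast
    then have x: "x \<in> M" "\<And>\<epsilon>. \<epsilon> > 0 \<Longrightarrow> \<exists>N. \<forall>n\<ge>N. c (u n) \<in> M \<and> d (c (u n)) x < \<epsilon>"
      unfolding limit_metric_sequentially by blast+
    have "d x (c (u k)) \<le> r k" for k
    proof (rule field_le_epsilon)
      fix \<epsilon> :: real assume "\<epsilon> > 0"
      then have half: "\<epsilon> / 2 > 0" by simp
      obtain N where N: "\<And>n. n \<ge> N \<Longrightarrow> d (c (u n)) x < \<epsilon> / 2" using x(2)[OF half] by blast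
      obtain N' where N': "r N' < \<epsilon> / 2" using r_small[OF half] by blast
      define n where "n = max N N'"
      have "d x (c (u k)) \<le> d x (c (u n)) + d (c (u n)) (c (u k))"
        by (rule triangle[OF x(1) cM cM])
      moreover have "d x (c (u n)) < \<epsilon> / 2" using N[of n] by (simp add: n_def commute)
      moreover have "d (c (u n)) (c (u k)) \<le> r n + r k" using u by (simp add: K_def)
      moreover have "r n \<le> r N'" by (rule r_mono) (simp add: n_def)
      ultimately show "d x (c (u k)) \<le> r k + \<epsilon>" using N' by linarith
    qed
    with x(1) show ?thesis unfolding lim_def by blast
  qed
  have lim_unique: "x = y" if "lim u x" "lim u y" for u x y
  proof (rule ccontr)
    assume "x \<noteq> y"
    have xy: "x \<in> M" "y \<in> M" using that by (simp_all add: lim_def)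
    then have "d x y / 2 > 0" using \<open>x \<noteq> y\<close> by simp
    then obtain k where "r k < d x y / 2" using r_small by blast
    moreover have "d x y \<le> d x (c (u k)) + d (c (u k)) y" by (rule triangle[OF xy(1) cM xy(2)])
    moreover have "d x (c (u k)) \<le> r k" "d (c (u k)) y \<le> r k"
      using that by (simp_all add: lim_def commute)
    ultimately show False by linarith
  qed
  define L where "L u = (if u \<in> K then SOME x. lim u x else c 0)" for u
  have L: "lim u (L u)" if "u \<in> K" for u
    using someI_ex[OF lim_ex[OF that]] that by (simp add: L_def)
  have L_M: "L u \<in> M" for u
    using L[of u] cM[of 0] by (cases "u \<in> K") (auto simp: lim_def L_def)
  have L_e: "L (e x) = x" if x: "x \<in> M" for x
  proof -
    have "e x \<in> K"
      unfolding K_def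
    proof (intro CollectI allI)
      fix k l
      have "d (c (e x k)) (c (e x l)) \<le> d (c (e x k)) x + d x (c (e x l))"
        by (rule triangle[OF cM x cM])
      then show "d (c (e x k)) (c (e x l)) \<le> r k + r l"
        using e[OF x, of k] e[OF x, of l] by (simp add: commute)
    qed
    moreover have "lim (e x) x" using x e[OF x] by (auto simp: lim_def intro: less_imp_le)
    ultimately show ?thesis using L lim_unique by blast
  qed
  have open_coord: "open {u :: nat \<Rightarrow> nat. Q (u k) (u l)}" for Q k l
  proof -
    have "open ((\<lambda>u :: nat \<Rightarrow> nat. u k) -` {a} \<inter> (\<lambda>u. u l) -` {b})" for a b
      by (intro open_Int open_vimage open_discrete continuous_on_product_coordinates)
    then have "open (\<Union>a. \<Union>b\<in>{b. Q a b}. (\<lambda>u :: nat \<Rightarrow> nat. u k) -` {a} \<inter> (\<lambda>u. u l) -` {b})"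
      by blast
    moreover have "(\<Union>a. \<Union>b\<in>{b. Q a b}. (\<lambda>u :: nat \<Rightarrow> nat. u k) -` {a} \<inter> (\<lambda>u. u l) -` {b})
        = {u. Q (u k) (u l)}" by auto
    ultimately show ?thesis by simp
  qed
  have K_borel: "K \<in> sets borel"
  proof -
    have "{u :: nat \<Rightarrow> nat. d (c (u k)) (c (u l)) \<le> r k + r l} \<in> sets borel" for k l
      using open_coord[of "\<lambda>a b. d (c a) (c b) \<le> r k + r l" k l] by simp
    then have "(\<Inter>k. \<Inter>l. {u :: nat \<Rightarrow> nat. d (c (u k)) (c (u l)) \<le> r k + r l}) \<in> sets borel"
      by (intro sets.countable_INT) blast+
    moreover have "(\<Inter>k. \<Inter>l. {u :: nat \<Rightarrow> nat. d (c (u k)) (c (u l)) \<le> r k + r l}) = K"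
      by (auto simp: K_def)
    ultimately show ?thesis by simp
  qed
  \<comment> \<open>\<open>L u\<close> is within \<open>r k\<close> of \<open>c (u k)\<close>, so
    the open ball of radius \<open>2 * r k\<close> contains it. That ball lies within
    \<open>3 * r k\<close> of \<open>L u\<close>, which explains the choice
    \<open>r k < \<epsilon> / 3\<close>.\<close>
  have L_K: "u \<in> K \<Longrightarrow> L u \<in> U \<longleftrightarrow> (\<exists>k. mball (c (u k)) (2 * r k) \<subseteq> U)"
    if U: "openin mtopology U" for U u
  proof
    assume u: "u \<in> K" and "L u \<in> U"
    then obtain \<epsilon> where \<epsilon>: "\<epsilon> > 0" "mball (L u) \<epsilon> \<subseteq> U" using U unfolding openin_mtopology by blast
    then obtain k where k: "r k < \<epsilon> / 3" using r_small[of "\<epsilon> / 3"] by auto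
    have "mball (c (u k)) (2 * r k) \<subseteq> mball (L u) \<epsilon>"
    proof
      fix y assume y: "y \<in> mball (c (u k)) (2 * r k)"
      then have "y \<in> M" "d (c (u k)) y < 2 * r k" by auto
      moreover have "d (L u) y \<le> d (L u) (c (u k)) + d (c (u k)) y"
        by (rule triangle[OF L_M cM \<open>y \<in> M\<close>])
      moreover have "d (L u) (c (u k)) \<le> r k" using L[OF u] by (simp add: lim_def)
      ultimately show "y \<in> mball (L u) \<epsilon>" using k L_M by simp
    qed
    then show "\<exists>k. mball (c (u k)) (2 * r k) \<subseteq> U" using \<epsilon>(2) by blast
  next
    assume u: "u \<in> K" and "\<exists>k. mball (c (u k)) (2 * r k) \<subseteq> U"
    then obtain k where k: "mball (c (u k)) (2 * r k) \<subseteq> U" by blast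
    have "d (L u) (c (u k)) \<le> r k" using L[OF u] by (simp add: lim_def)
    then have "L u \<in> mball (c (u k)) (2 * r k)"
      using r_pos[of k] L_M cM by (simp add: commute)
    then show "L u \<in> U" using k by blast
  qed
  have "L \<in> borel \<rightarrow>\<^sub>M X"
  proof (rule measurable_sigma_sets[OF T(4)])
    show "{U. openin T U} \<subseteq> Pow (space X)" using T(3) openin_subset by blast
    show "L \<in> space borel \<rightarrow> space X" using L_M M by simp
    fix U assume "U \<in> {U. openin T U}"
    then have U: "openin mtopology U" using Md(3) by simp
    have "(\<Union>k. {u. mball (c (u k)) (2 * r k) \<subseteq> U}) \<in> sets borel"
      using open_coord[of "\<lambda>a b. mball (c a) (2 * r _) \<subseteq> U"] by (intro borel_open) blast
    then have "K \<inter> (\<Union>k. {u. mball (c (u k)) (2 * r k) \<subseteq> U}) \<union> (if c 0 \<in> U then - K else {}) \<in> sets borel"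
      using K_borel by auto
    moreover have "L -` U \<inter> space borel =
        K \<inter> (\<Union>k. {u. mball (c (u k)) (2 * r k) \<subseteq> U}) \<union> (if c 0 \<in> U then - K else {})"
    proof (rule set_eqI)
      fix u
      show "u \<in> L -` U \<inter> space borel \<longleftrightarrow>
          u \<in> K \<inter> (\<Union>k. {u. mball (c (u k)) (2 * r k) \<subseteq> U}) \<union> (if c 0 \<in> U then - K else {})"
      proof (cases "u \<in> K")
        case True
        then show ?thesis using L_K[OF U True] by simp
      next
        case False
        then have "L u = c 0" by (simp add: L_def)
        then show ?thesis using False by simp
      qed
    qed
    ultimately show "L -` U \<inter> space borel \<in> sets borel" by simp
  qed
  moreover have "e \<in> X \<rightarrow>\<^sub>M borel"
  proof (rule measurable_coordinatewise_then_product)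
    fix k
    have "{x \<in> space X. d x (c n) < r k} \<in> sets X" for n
    proof -
      have "mball (c n) (r k) \<in> sets X"
        unfolding T(4) by (rule sigma_sets.Basic) (simp add: Md(3))
      moreover have "mball (c n) (r k) = {x \<in> space X. d x (c n) < r k}"
        unfolding M[symmetric] using cM by (auto simp: commute)
      ultimately show ?thesis by simp
    qed
    then have "(\<lambda>x. e x k) \<in> measurable X (count_space UNIV)"
      unfolding e_def by (intro measurable_Least) (simp add: pred_def)
    then show "(\<lambda>x. e x k) \<in> borel_measurable X"
      by (simp add: measurable_cong_sets[OF refl sets_borel_eq_count_space])
  qed
  ultimately show thesis using L_e M by (intro that[of e L]) simp_all
qed

text \<open>\<open>e\<close> is injective on \<open>space X\<close>, so equality can be tested in
  Baire space.\<close>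

lemma standard_borel_equality_set:
  assumes "standard_borel_space X" "f \<in> N \<rightarrow>\<^sub>M X" "g \<in> N \<rightarrow>\<^sub>M X"
  shows "{x \<in> space N. f x = g x} \<in> sets N"
proof (cases "space X = {}")
  case True
  then have "space N = {}" using measurable_space[OF assms(2)] by blast
  then show ?thesis by simp
next
  case False
  from standard_borel_retract_of_baire[OF assms(1) False]
  obtain e :: "'a \<Rightarrow> (nat \<Rightarrow> nat)" and L :: "(nat \<Rightarrow> nat) \<Rightarrow> 'a"
    where e: "e \<in> X \<rightarrow>\<^sub>M borel" and L: "\<And>x. x \<in> space X \<Longrightarrow> L (e x) = x"
    by metis
  have "e (f x) = e (g x) \<longleftrightarrow> f x = g x" if "x \<in> space N" for x
    using L[OF measurable_space[OF assms(2) that]] L[OF measurable_space[OF assms(3) that]] by metis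
  then have "{x \<in> space N. f x = g x} = {x \<in> space N. e (f x) = e (g x)}" by blast
  also have "\<dots> \<in> sets N"
    by (intro measurable_equality_set measurable_compose[OF assms(2) e] measurable_compose[OF assms(3) e])
  finally show ?thesis .
qed

lemma countable_sections_covered_by_functions:
  assumes "standard_borel_space X" "R \<in> sets (X \<Otimes>\<^sub>M X)" "\<And>x. x \<in> space X \<Longrightarrow> countable (R `` {x})"
  obtains g :: "nat \<Rightarrow> 'a \<Rightarrow> 'a"
  where "\<And>n. g n \<in> X \<rightarrow>\<^sub>M X" "\<And>x y. (x, y) \<in> R \<Longrightarrow> \<exists>n. y = g n x"
proof (cases "space X = {}")
  case True
  have "R \<subseteq> space X \<times> space X"
    using sets.sets_into_space[OF assms(2)] by (simp add: space_pair_measure)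
  then have "R = {}" using True by blast
  then show thesis by (intro that[of "\<lambda>_ x. x"]) auto
next
  case False
  from standard_borel_retract_of_baire[OF assms(1) False]
  obtain e :: "'a \<Rightarrow> (nat \<Rightarrow> nat)" and L :: "(nat \<Rightarrow> nat) \<Rightarrow> 'a"
    where e: "e \<in> X \<rightarrow>\<^sub>M borel" and L: "L \<in> borel \<rightarrow>\<^sub>M X" "\<And>x. x \<in> space X \<Longrightarrow> L (e x) = x"
    by metis
  \<comment> \<open>Many codes may decode to one point. The second condition keeps only the code
    that \<open>e\<close> produces, so the sections of \<open>P\<close> stay countable.\<close>
  define P where "P = {p :: (nat \<Rightarrow> nat) \<times> (nat \<Rightarrow> nat). (L (fst p), L (snd p)) \<in> R}
      \<inter> {p. e (L (snd p)) = snd p}"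
  have fst_snd: "(fst :: (nat \<Rightarrow> nat) \<times> (nat \<Rightarrow> nat) \<Rightarrow> _) \<in> borel \<rightarrow>\<^sub>M borel"
      "(snd :: (nat \<Rightarrow> nat) \<times> (nat \<Rightarrow> nat) \<Rightarrow> _) \<in> borel \<rightarrow>\<^sub>M borel"
    by (intro borel_measurable_continuous_onI continuous_intros)+
  have Lfst: "(\<lambda>p :: (nat \<Rightarrow> nat) \<times> (nat \<Rightarrow> nat). L (fst p)) \<in> borel \<rightarrow>\<^sub>M X"
    and Lsnd: "(\<lambda>p :: (nat \<Rightarrow> nat) \<times> (nat \<Rightarrow> nat). L (snd p)) \<in> borel \<rightarrow>\<^sub>M X"
    by (rule measurable_compose[OF fst_snd(1) L(1)], rule measurable_compose[OF fst_snd(2) L(1)])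
  have "{p :: (nat \<Rightarrow> nat) \<times> (nat \<Rightarrow> nat). (L (fst p), L (snd p)) \<in> R} \<in> sets borel"
    using measurable_sets[OF measurable_Pair[OF Lfst Lsnd] assms(2)] by (simp add: vimage_def)
  moreover have "{p :: (nat \<Rightarrow> nat) \<times> (nat \<Rightarrow> nat). e (L (snd p)) = snd p} \<in> sets borel"
    using measurable_equality_set[OF measurable_compose[OF Lsnd e] fst_snd(2)] by simp
  ultimately have "P \<in> sets borel" unfolding P_def by (rule sets.Int)
  then have "suslin P" by (rule suslin_borel)
  have P_ctb: "countable (P `` {u})" for u
  proof (rule countable_subset)
    show "P `` {u} \<subseteq> e ` (R `` {L u})" by (force simp: P_def)
    have "L u \<in> space X" using measurable_space[OF L(1), of u] by simp
    then show "countable (e ` (R `` {L u}))" by (intro countable_image assms(3))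
  qed
  obtain f :: "nat \<Rightarrow> (nat \<Rightarrow> nat) \<Rightarrow> (nat \<Rightarrow> nat)"
    where f: "\<And>n. f n \<in> borel_measurable borel" "\<And>x y. (x, y) \<in> P \<Longrightarrow> \<exists>n. y = f n x"
    using that by (rule lusin_novikov[OF \<open>suslin P\<close> P_ctb])
  show thesis
  proof (rule that[of "\<lambda>n x. L (f n (e x))"])
    show "(\<lambda>x. L (f n (e x))) \<in> X \<rightarrow>\<^sub>M X" for n
      by (rule measurable_compose[OF measurable_compose[OF e f(1)] L(1)])
    fix x y assume xy: "(x, y) \<in> R"
    then have "x \<in> space X" "y \<in> space X"
      using sets.sets_into_space[OF assms(2)] by (auto simp: space_pair_measure)
    then have "L (e x) = x" "L (e y) = y" by (simp_all add: L(2))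
    then have "(e x, e y) \<in> P" using xy by (simp add: P_def)
    then obtain n where "e y = f n (e x)" using f(2) by blast
    then have "y = L (f n (e x))" using \<open>L (e y) = y\<close> by simp
    then show "\<exists>n. y = L (f n (e x))" ..
  qed
qed

section \<open>Contracting a treeing to a sub-relation\<close>

text \<open>A shortest walk from \<open>v\<close> to \<open>u\<close> avoiding the edge repeats no
  vertex, and the edge closes it to a cycle. It has at least two steps because \<open>u\<close> and
  \<open>v\<close> differ and the direct step is removed, which gives the three vertices that a
  cycle requires.\<close>

lemma bypassed_edge_not_acyclic:
  assumes "G \<inter> Id = {}" "(u, v) \<in> G" "(v, u) \<in> (G - {(u, v), (v, u)})\<^sup>*"
  shows "\<not> graph_acyclic G"
proof -
  let ?G = "G - {(u, v), (v, u)}"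
  let ?P = "\<lambda>n. (v, u) \<in> ?G ^^ n"
  obtain n where n: "?P n" "\<And>m. m < n \<Longrightarrow> \<not> ?P m"
    using assms(3) exists_least_iff[of ?P] by (metis rtrancl_imp_relpow)
  obtain f where f: "f 0 = v" "f n = u" "\<And>i. i < n \<Longrightarrow> (f i, f (Suc i)) \<in> ?G"
    using n(1) unfolding relpow_fun_conv by blast
  have "u \<noteq> v" using assms(1,2) by blast
  have n2: "2 \<le> n"
  proof (rule ccontr)
    assume "\<not> 2 \<le> n"
    then consider "n = 0" | "n = 1" by linarith
    then show False
      using f \<open>u \<noteq> v\<close> by cases auto
  qed
  have neq: "f i \<noteq> f j" if ij: "i < j" "j \<le> n" for i j
  proof
    assume eq: "f i = f j"
    \<comment> \<open>The walk with the loop between positions \<open>i\<close> and \<open>j\<close>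
      cut out; it would be shorter.\<close>
    define h where "h k = (if k \<le> i then f k else f (k + (j - i)))" for k
    have "h 0 = v" using f(1) by (simp add: h_def)
    moreover have "h (n - (j - i)) = u"
    proof (cases "j = n")
      case False
      then have "\<not> n - (j - i) \<le> i" "n - (j - i) + (j - i) = n" using ij by linarith+
      then show ?thesis using f(2) by (simp only: h_def if_False)
    qed (use f(2) ij eq in \<open>simp add: h_def\<close>)
    moreover have "(h k, h (Suc k)) \<in> ?G" if k: "k < n - (j - i)" for k
    proof -
      consider "Suc k \<le> i" | "k = i" | "i < k" by linarith
      then show ?thesis
      proof cases
        case 1
        then show ?thesis using f(3)[of k] ij by (simp add: h_def)
      next
        case 2
        then show ?thesis using f(3)[of j] ij eq k by (simp add: h_def)
      next
        case 3
        then show ?thesis using f(3)[of "k + (j - i)"] ij k by (simp add: h_def)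
      qed
    qed
    ultimately have "?P (n - (j - i))" unfolding relpow_fun_conv by blast
    moreover have "n - (j - i) < n" using ij by linarith
    ultimately show False using n(2) by blast
  qed
  define p where "p = map f [0..<Suc n]"
  have len: "length p = Suc n" by (simp add: p_def)
  have nth: "p ! i = f i" if "i \<le> n" for i
    using that unfolding p_def by (subst nth_map) (simp_all del: upt_Suc)
  have "distinct p"
    unfolding distinct_conv_nth len
  proof (intro allI impI)
    fix i j assume "i < Suc n" "j < Suc n" "i \<noteq> j"
    then show "p ! i \<noteq> p ! j"
      using neq[of i j] neq[of j i] nth[of i] nth[of j] by (cases "i < j") auto
  qed
  moreover have "(p ! i, p ! (Suc i mod length p)) \<in> G" if "i < length p" for i
  proof (cases "i = n")
    case True
    then show ?thesis using nth[of n] nth[of 0] f(1,2) assms(2) len by simp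
  next
    case False
    then have "i < n" using that len by simp
    then show ?thesis using nth[of i] nth[of "Suc i"] f(3)[of i] len by simp
  qed
  ultimately have "graph_cycle G p"
    using n2 len by (simp add: graph_cycle_def)
  then show ?thesis by (auto simp: graph_acyclic_def)
qed

text \<open>Contracting connected cells: a cycle of cells through the edge \<open>(y, z)\<close> would give a path
  in \<^term>\<open>G\<close> from \<open>z\<close> back to \<open>y\<close> that avoids this edge.\<close>

lemma graph_acyclic_contraction:
  assumes "sym G" "G \<inter> Id = {}" "graph_acyclic G"
    and closed: "\<And>y z. (y, z) \<in> G \<Longrightarrow> y \<in> V \<Longrightarrow> z \<in> V"
    and conn: "\<And>y. y \<in> V \<Longrightarrow> (y, r y) \<in> {(y, z) \<in> G. r y = r z}\<^sup>*"
  shows "graph_acyclic {(r y, r z) | y z. (y, z) \<in> G \<and> y \<in> V \<and> r y \<noteq> r z}"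
  unfolding graph_acyclic_def
proof
  assume "\<exists>p. graph_cycle {(r y, r z) | y z. (y, z) \<in> G \<and> y \<in> V \<and> r y \<noteq> r z} p"
  then obtain p where p: "3 \<le> length p" "distinct p"
    "\<And>i. i < length p \<Longrightarrow> \<exists>y z. (y, z) \<in> G \<and> y \<in> V \<and> r y = p ! i \<and> r z = p ! (Suc i mod length p)"
    unfolding graph_cycle_def by force
  let ?m = "length p"
  obtain y z where yz: "\<And>i. i < ?m \<Longrightarrow> (y i, z i) \<in> G \<and> y i \<in> V \<and> r (y i) = p ! i \<and> r (z i) = p ! (Suc i mod ?m)"
    using p(3) by metis
  let ?G = "G - {(y 0, z 0), (z 0, y 0)}"
  let ?I = "{(y, z) \<in> G. r y = r z}"
  have m0: "0 < ?m" "1 < ?m" using p(1) by linarith+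
  have r0: "r (y 0) = p ! 0" "r (z 0) = p ! 1"
    using yz[OF m0(1)] m0(2) by simp_all
  have "p ! 0 \<noteq> p ! 1" using p(2) m0 by (simp add: nth_eq_iff_index_eq)
  \<comment> \<open>An edge inside a cell has equal roots at its ends, while \<open>y 0\<close> and
    \<open>z 0\<close> have different ones; so removing that edge leaves all cells
    connected.\<close>
  then have "?I \<subseteq> ?G" using r0 by auto
  then have I_G: "?I\<^sup>* \<subseteq> ?G\<^sup>*" by (rule rtrancl_mono)
  have "sym ?I" using assms(1) by (auto simp: sym_def)
  then have "sym (?I\<^sup>*)" by (rule sym_rtrancl)
  have cell: "(a, b) \<in> ?G\<^sup>*" if ab: "a \<in> V" "b \<in> V" "r a = r b" for a b
  proof -
    have "(a, r a) \<in> ?I\<^sup>*" "(r a, b) \<in> ?I\<^sup>*"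
      using conn[OF ab(1)] symD[OF \<open>sym (?I\<^sup>*)\<close> conn[OF ab(2)]] ab(3) by simp_all
    then show ?thesis using I_G rtrancl_trans by (metis (no_types, lifting) subsetD)
  qed
  have zV: "z i \<in> V" if "i < ?m" for i using yz[OF that] closed by blast
  have edge: "(y i, z i) \<in> ?G" if i: "0 < i" "i < ?m" for i
  proof -
    have "y i \<noteq> y 0"
    proof
      assume "y i = y 0"
      then have "p ! i = p ! 0" using yz[OF i(2)] yz[OF m0(1)] by simp
      then show False using p(2) i m0 by (simp add: nth_eq_iff_index_eq)
    qed
    moreover have "\<not> (y i = z 0 \<and> z i = y 0)"
    proof
      assume eq: "y i = z 0 \<and> z i = y 0"
      then have "p ! i = p ! 1" "p ! (Suc i mod ?m) = p ! 0"
        using yz[OF i(2)] r0 by simp_all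
      moreover have "Suc i mod ?m < ?m" using m0 by simp
      \<comment> \<open>Traversing the removed edge backwards would close the cycle of cells after
        two steps, but it has length at least 3.\<close>
      ultimately have "i = 1" "Suc i mod ?m = 0"
        using p(2) i m0 by (simp_all add: nth_eq_iff_index_eq)
      then show False using p(1) by simp
    qed
    ultimately show ?thesis using yz[OF i(2)] by auto
  qed
  have path: "(z 0, z i) \<in> ?G\<^sup>*" if "i < ?m" for i
    using that
  proof (induction i)
    case (Suc i)
    have "(z i, y (Suc i)) \<in> ?G\<^sup>*"
      using Suc.prems yz[of i] yz[of "Suc i"] zV[of i] by (intro cell) auto
    moreover have "(y (Suc i), z (Suc i)) \<in> ?G" using Suc.prems by (intro edge) auto
    moreover have "(z 0, z i) \<in> ?G\<^sup>*" using Suc by simp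
    ultimately show ?case by (meson rtrancl_trans rtrancl.rtrancl_into_rtrancl)
  qed simp
  have "(z (?m - 1), y 0) \<in> ?G\<^sup>*"
    using m0 yz[of "?m - 1"] yz[of 0] zV[of "?m - 1"] by (intro cell) auto
  with path[of "?m - 1"] have "(z 0, y 0) \<in> ?G\<^sup>*" using m0 by (auto intro: rtrancl_trans)
  then show False
    using bypassed_edge_not_acyclic[OF assms(2)] yz[OF m0(1)] assms(3) by blast
qed

section \<open>Roots of cells around a class\<close>

text \<open>Recursion on the radius adds one quantifier over neighbours per step, which an
  enumeration of the neighbours makes countable; this is what makes the balls Borel uniformly in the
  base point.\<close>

primrec graph_ball :: "('a \<times> 'a) set \<Rightarrow> 'a set \<Rightarrow> nat \<Rightarrow> 'a set" where
  "graph_ball G C 0 = C"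
| "graph_ball G C (Suc n) = graph_ball G C n \<union> {y. \<exists>z. (y, z) \<in> G \<and> z \<in> graph_ball G C n}"

text \<open>
  Everything below depends on the base point only through its \<open>S\<close>-class \<open>C\<close>, which makes
  \<open>S\<close>-invariance automatic.  The \<open>g k\<close> enumerate the neighbours, so the parent is the first
  neighbour closer to \<open>C\<close>; for vertices not connected to \<open>C\<close> these functions are junk.
\<close>

definition level :: "('a \<times> 'a) set \<Rightarrow> 'a set \<Rightarrow> 'a \<Rightarrow> nat" where
  "level G C y = (LEAST n. y \<in> graph_ball G C n)"

definition parent :: "('a \<times> 'a) set \<Rightarrow> (nat \<Rightarrow> 'a \<Rightarrow> 'a) \<Rightarrow> 'a set \<Rightarrow> 'a \<Rightarrow> 'a" where
  "parent G g C y =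
     (if y \<in> C then y else g (LEAST k. (y, g k y) \<in> G \<and> level G C (g k y) < level G C y) y)"

definition cell_root :: "('a \<times> 'a) set \<Rightarrow> (nat \<Rightarrow> 'a \<Rightarrow> 'a) \<Rightarrow> 'a set \<Rightarrow> 'a \<Rightarrow> 'a" where
  "cell_root G g C y = (parent G g C ^^ (LEAST n. (parent G g C ^^ n) y \<in> C)) y"

lemma graph_ball_exhausts:
  assumes "(y, c) \<in> G\<^sup>*" "c \<in> C"
  shows "\<exists>n. y \<in> graph_ball G C n"
  using assms(1)
proof (induction rule: converse_rtrancl_induct)
  case base
  show ?case using assms(2) by (intro exI[of _ 0]) simp
next
  case (step y z)
  then obtain n where "z \<in> graph_ball G C n" by blast
  then show ?case using step.hyps(1) by (intro exI[of _ "Suc n"]) auto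
qed

text \<open>Outside \<open>C\<close> the level is a successor, and the ball recursion supplies a
  neighbour of smaller level. As \<open>g\<close> enumerates the neighbours, the search in
  \<open>parent\<close> succeeds.\<close>

lemma parent_step:
  assumes g: "\<And>y z. (y, z) \<in> G \<Longrightarrow> \<exists>k. z = g k y"
    and "(y, c) \<in> G\<^sup>*" "c \<in> C" "y \<notin> C"
  shows "(y, parent G g C y) \<in> G" "level G C (parent G g C y) < level G C y"
proof -
  have ball: "y \<in> graph_ball G C (level G C y)"
    unfolding level_def using graph_ball_exhausts[OF assms(2,3)] by (rule LeastI_ex)
  then obtain m where m: "level G C y = Suc m"
    using assms(4) by (cases "level G C y") auto
  have "y \<notin> graph_ball G C m"
    using m unfolding level_def by (metis lessI not_less_Least)
  then obtain z where z: "(y, z) \<in> G" "z \<in> graph_ball G C m"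
    using ball m by auto
  have "level G C z < level G C y"
    using Least_le[of "\<lambda>n. z \<in> graph_ball G C n" m] z(2) m unfolding level_def by linarith
  then have "\<exists>k. (y, g k y) \<in> G \<and> level G C (g k y) < level G C y"
    using g[OF z(1)] z(1) by blast
  from LeastI_ex[OF this] show "(y, parent G g C y) \<in> G" "level G C (parent G g C y) < level G C y"
    using assms(4) by (simp_all add: parent_def)
qed

lemma cell_root_of_mem: "y \<in> C \<Longrightarrow> cell_root G g C y = y"
  unfolding cell_root_def by (subst Least_eq_0) simp_all

text \<open>By induction on the level: iterating from the parent of \<open>y\<close> is iterating
  from \<open>y\<close> one step later, so both have the same root and the edge between them stays
  in the cell. This connectedness is what the contraction of cells requires.\<close>

lemma cell_root_mem_and_path:
  assumes g: "\<And>y z. (y, z) \<in> G \<Longrightarrow> \<exists>k. z = g k y" and "sym G"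
    and "(y, c) \<in> G\<^sup>*" "c \<in> C"
  shows "cell_root G g C y \<in> C"
    and "(y, cell_root G g C y) \<in> {(y, z) \<in> G. cell_root G g C y = cell_root G g C z}\<^sup>*"
proof -
  let ?f = "parent G g C"
  have "(\<exists>n. (?f ^^ n) y \<in> C) \<and> (y, cell_root G g C y) \<in> {(y, z) \<in> G. cell_root G g C y = cell_root G g C z}\<^sup>*"
    using assms(3)
  proof (induction "level G C y" arbitrary: y rule: less_induct)
    case less
    show ?case
    proof (cases "y \<in> C")
      case True
      then show ?thesis by (auto simp: cell_root_of_mem intro: exI[of _ 0])
    next
      case False
      have step: "(y, ?f y) \<in> G" "level G C (?f y) < level G C y"
        using parent_step[of G g y c C] g less.prems assms(4) False by blast+
      have "(?f y, c) \<in> G\<^sup>*"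
        using symD[OF assms(2) step(1)] less.prems by (rule converse_rtrancl_into_rtrancl)
      from less.hyps[OF step(2) this]
      obtain n where n: "(?f ^^ n) (?f y) \<in> C"
        and path: "(?f y, cell_root G g C (?f y)) \<in> {(y, z) \<in> G. cell_root G g C y = cell_root G g C z}\<^sup>*" by blast
      have Suc_n: "(?f ^^ Suc n) y \<in> C" using n by (simp only: funpow_Suc_right o_apply)
      have "cell_root G g C y = cell_root G g C (?f y)"
      proof -
        have "(LEAST n. (?f ^^ n) y \<in> C) = Suc (LEAST n. (?f ^^ Suc n) y \<in> C)"
          by (rule Least_Suc[of "\<lambda>n. (?f ^^ n) y \<in> C", OF Suc_n]) (use False in simp)
        then show ?thesis unfolding cell_root_def by (simp only: funpow_Suc_right o_apply)
      qed
      then show ?thesis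
      proof (intro conjI)
        have "(y, ?f y) \<in> {(y, z) \<in> G. cell_root G g C y = cell_root G g C z}"
          using step(1) \<open>cell_root G g C y = cell_root G g C (?f y)\<close> by simp
        then show "(y, cell_root G g C y) \<in> {(y, z) \<in> G. cell_root G g C y = cell_root G g C z}\<^sup>*"
          using path unfolding \<open>cell_root G g C y = cell_root G g C (?f y)\<close>
          by (rule converse_rtrancl_into_rtrancl)
      qed (use Suc_n in blast)
    qed
  qed
  then show "cell_root G g C y \<in> C" "(y, cell_root G g C y) \<in> {(y, z) \<in> G. cell_root G g C y = cell_root G g C z}\<^sup>*"
    unfolding cell_root_def using LeastI_ex[of "\<lambda>n. (?f ^^ n) y \<in> C"] by blast+
qed

section \<open>Borel measurability of the contraction\<close>

text \<open>Each ingredient is treated as a function of the pair of base point and vertex. A least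
  index depends on the pair in a Borel way, and choosing among countably many Borel functions by
  such an index is again Borel.\<close>

lemma measurable_cell_root:
  fixes X :: "'a measure"
  assumes S: "S \<in> sets (X \<Otimes>\<^sub>M X)" and G: "G \<in> sets (X \<Otimes>\<^sub>M X)"
    and g: "\<And>n. g n \<in> X \<rightarrow>\<^sub>M X" "\<And>y z. (y, z) \<in> G \<Longrightarrow> \<exists>k. z = g k y"
  shows "(\<lambda>p. cell_root G g (S `` {fst p}) (snd p)) \<in> X \<Otimes>\<^sub>M X \<rightarrow>\<^sub>M X"
proof -
  let ?M = "X \<Otimes>\<^sub>M X"
  have [measurable]: "Measurable.pred ?M (\<lambda>p. p \<in> S)" "Measurable.pred ?M (\<lambda>p. p \<in> G)"
    using S G by (simp_all add: pred_def)
  have gs [measurable]: "(\<lambda>p. (fst p, g k (snd p))) \<in> ?M \<rightarrow>\<^sub>M ?M" for k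
    by (intro measurable_Pair measurable_fst measurable_compose[OF measurable_snd g(1)])
  have edge [measurable]: "Measurable.pred ?M (\<lambda>p. (snd p, g k (snd p)) \<in> G)" for k
    by (rule measurable_compose[of "\<lambda>p. (snd p, g k (snd p))" ?M ?M])
      (intro measurable_Pair measurable_snd measurable_compose[OF measurable_snd g(1)], measurable)
  have C [measurable]: "Measurable.pred ?M (\<lambda>p. snd p \<in> S `` {fst p})"
    by simp
  have [measurable]: "Measurable.pred ?M (\<lambda>p. snd p \<in> graph_ball G (S `` {fst p}) n)" for n
  proof (induction n)
    case (Suc n)
    have [measurable]: "Measurable.pred ?M (\<lambda>p. g k (snd p) \<in> graph_ball G (S `` {fst p}) n)" for k
      using measurable_compose[OF gs Suc] by simp
    \<comment> \<open>As every neighbour is some \<open>g k (snd p)\<close>, the quantifier over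
      neighbours becomes a countable one over \<open>k\<close>.\<close>
    have "snd p \<in> graph_ball G (S `` {fst p}) (Suc n) \<longleftrightarrow> snd p \<in> graph_ball G (S `` {fst p}) n \<or>
        (\<exists>k. (snd p, g k (snd p)) \<in> G \<and> g k (snd p) \<in> graph_ball G (S `` {fst p}) n)" for p
      using g(2) by (simp; blast)
    moreover have "Measurable.pred ?M (\<lambda>p. snd p \<in> graph_ball G (S `` {fst p}) n \<or>
        (\<exists>k. (snd p, g k (snd p)) \<in> G \<and> g k (snd p) \<in> graph_ball G (S `` {fst p}) n))"
      using Suc by measurable
    ultimately show ?case by simp
  qed (use C in simp)
  then have lev [measurable]: "(\<lambda>p. level G (S `` {fst p}) (snd p)) \<in> ?M \<rightarrow>\<^sub>M count_space UNIV"
    unfolding level_def by measurable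
  have [measurable]: "(\<lambda>p. level G (S `` {fst p}) (g k (snd p))) \<in> ?M \<rightarrow>\<^sub>M count_space UNIV" for k
    using measurable_compose[OF gs lev] by simp
  then have [measurable]: "Measurable.pred ?M
      (\<lambda>p. level G (S `` {fst p}) (g k (snd p)) < level G (S `` {fst p}) (snd p))" for k
    using lev by (intro borel_measurable_pred_less)
      (simp_all add: measurable_cong_sets[OF refl sets_borel_eq_count_space])
  have "(\<lambda>p. LEAST k. (snd p, g k (snd p)) \<in> G \<and>
      level G (S `` {fst p}) (g k (snd p)) < level G (S `` {fst p}) (snd p)) \<in> ?M \<rightarrow>\<^sub>M count_space UNIV"
    by measurable
  then have "(\<lambda>p. g (LEAST k. (snd p, g k (snd p)) \<in> G \<and>
      level G (S `` {fst p}) (g k (snd p)) < level G (S `` {fst p}) (snd p)) (snd p)) \<in> ?M \<rightarrow>\<^sub>M X"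
    by (rule measurable_compose_countable[rotated]) (rule measurable_compose[OF measurable_snd g(1)])
  then have par: "(\<lambda>p. parent G g (S `` {fst p}) (snd p)) \<in> ?M \<rightarrow>\<^sub>M X"
    unfolding parent_def using C by (intro measurable_If) (auto simp: pred_def)
  have iter: "(\<lambda>p. (parent G g (S `` {fst p}) ^^ n) (snd p)) \<in> ?M \<rightarrow>\<^sub>M X" for n
  proof (induction n)
    case (Suc n)
    show ?case
      using measurable_compose[OF measurable_Pair[OF measurable_fst Suc] par] by simp
  qed simp
  have "Measurable.pred ?M (\<lambda>p. (parent G g (S `` {fst p}) ^^ n) (snd p) \<in> S `` {fst p})" for n
    using measurable_compose[OF measurable_Pair[OF measurable_fst iter] C] by simp
  then have "(\<lambda>p. LEAST n. (parent G g (S `` {fst p}) ^^ n) (snd p) \<in> S `` {fst p}) \<in> ?M \<rightarrow>\<^sub>M count_space UNIV"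
    by (rule measurable_Least)
  then show ?thesis
    unfolding cell_root_def by (rule measurable_compose_countable[rotated]) (rule iter)
qed

text \<open>Roots are meaningful only for vertices connected to the class. The condition
  \<open>(a, y) \<in> R\<close> keeps the witnessing edge in the \<open>R\<close>-class of
  \<open>a\<close>, and it also allows \<open>y\<close> to be named as some
  \<open>g k a\<close>.\<close>

definition contracted_graph :: "('a \<times> 'a) set \<Rightarrow> (nat \<Rightarrow> 'a \<Rightarrow> 'a) \<Rightarrow> ('a \<times> 'a) set \<Rightarrow> ('a \<times> 'a) set \<Rightarrow> ('a \<times> 'a) set" where
  "contracted_graph G g R S = {(a, b) \<in> S. a \<noteq> b \<and> (\<exists>y z. (y, z) \<in> G \<and> (a, y) \<in> R \<and>
     cell_root G g (S `` {a}) y = a \<and> cell_root G g (S `` {a}) z = b)}"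

text \<open>Both ends of a witnessing edge lie in the \<open>R\<close>-class of \<open>a\<close>, so
  the quantifiers over them range over the indices of \<open>g k a\<close> and \<open>g l a\<close>.
  The equations for the roots are Borel conditions because the diagonal of a standard Borel space
  is.\<close>

lemma measurable_contracted_graph:
  fixes X :: "'a measure"
  assumes X: "standard_borel_space X"
    and S: "S \<in> sets (X \<Otimes>\<^sub>M X)" and G: "G \<in> sets (X \<Otimes>\<^sub>M X)" and R: "R \<in> sets (X \<Otimes>\<^sub>M X)"
    and "trans R" "G \<subseteq> R"
    and g: "\<And>n. g n \<in> X \<rightarrow>\<^sub>M X" "\<And>y z. (y, z) \<in> R \<Longrightarrow> \<exists>k. z = g k y"
  shows "contracted_graph G g R S \<in> sets (X \<Otimes>\<^sub>M X)"
proof -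
  let ?M = "X \<Otimes>\<^sub>M X"
  have root: "(\<lambda>p. cell_root G g (S `` {fst p}) (snd p)) \<in> ?M \<rightarrow>\<^sub>M X"
    using S G g assms(6) by (intro measurable_cell_root) blast+
  have gf: "(\<lambda>p. g k (fst p)) \<in> ?M \<rightarrow>\<^sub>M X" for k
    by (rule measurable_compose[OF measurable_fst g(1)])
  have rg: "(\<lambda>p. cell_root G g (S `` {fst p}) (g k (fst p))) \<in> ?M \<rightarrow>\<^sub>M X" for k
    using measurable_compose[OF measurable_Pair[OF measurable_fst gf] root] by simp
  have mem: "{p \<in> space ?M. (u p, v p) \<in> T} \<in> sets ?M"
    if "T \<in> sets ?M" "u \<in> ?M \<rightarrow>\<^sub>M X" "v \<in> ?M \<rightarrow>\<^sub>M X" for u v T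
    using measurable_sets[OF measurable_Pair[OF that(2,3)] that(1)]
    by (simp add: vimage_def Int_def conj_commute)
  define A where "A k l = {p \<in> space ?M. (g k (fst p), g l (fst p)) \<in> G} \<inter>
      {p \<in> space ?M. (fst p, g k (fst p)) \<in> R} \<inter>
      {p \<in> space ?M. cell_root G g (S `` {fst p}) (g k (fst p)) = fst p} \<inter>
      {p \<in> space ?M. cell_root G g (S `` {fst p}) (g l (fst p)) = snd p}" for k l
  have "A k l \<in> sets ?M" for k l
    unfolding A_def
    by (intro sets.Int mem G R gf measurable_fst standard_borel_equality_set[OF X] rg measurable_snd)
  moreover have "{p \<in> space ?M. fst p = snd p} \<in> sets ?M"
    by (intro standard_borel_equality_set[OF X] measurable_fst measurable_snd)
  ultimately have "(S - {p \<in> space ?M. fst p = snd p}) \<inter> (\<Union>k. \<Union>l. A k l) \<in> sets ?M"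
    using S by blast
  moreover have "(S - {p \<in> space ?M. fst p = snd p}) \<inter> (\<Union>k. \<Union>l. A k l) = contracted_graph G g R S"
  proof (intro set_eqI iffI)
    fix p assume "p \<in> (S - {p \<in> space ?M. fst p = snd p}) \<inter> (\<Union>k. \<Union>l. A k l)"
    then show "p \<in> contracted_graph G g R S"
      by (cases p) (auto simp: A_def contracted_graph_def)
  next
    fix p assume p: "p \<in> contracted_graph G g R S"
    obtain a b where ab: "p = (a, b)" by fastforce
    from p ab obtain y z where yz: "(a, b) \<in> S" "a \<noteq> b" "(y, z) \<in> G" "(a, y) \<in> R"
        "cell_root G g (S `` {a}) y = a" "cell_root G g (S `` {a}) z = b"
      by (auto simp: contracted_graph_def)
    have "(a, z) \<in> R" using transD[OF assms(5) yz(4)] yz(3) assms(6) by blast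
    then obtain k l where "y = g k a" "z = g l a" using g(2) yz(4) by blast
    moreover have "(a, b) \<in> space ?M" using yz(1) sets.sets_into_space[OF S] by blast
    ultimately have "(a, b) \<in> A k l" using yz by (simp add: A_def)
    then show "p \<in> (S - {p \<in> space ?M. fst p = snd p}) \<inter> (\<Union>k. \<Union>l. A k l)"
      using yz(1,2) ab by auto
  qed
  ultimately show ?thesis by simp
qed

section \<open>The contracted graph as a treeing of the sub-relation\<close>

theorem mainTheorem3:
  fixes X :: "'a measure" and R S :: "('a \<times> 'a) set"
  assumes "standard_borel_space X"
    and "borel_equiv_rel X R"
    and "countable_classes X R"
    and "arborable X R"
    and "sub_relation X R S"
  shows "arborable X S"
proof -
  have R: "R \<in> sets (X \<Otimes>\<^sub>M X)" "equiv (space X) R"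
    using assms(2) by (simp_all add: borel_equiv_rel_def)
  have S: "S \<in> sets (X \<Otimes>\<^sub>M X)" "equiv (space X) S" "S \<subseteq> R"
    using assms(5) by (simp_all add: sub_relation_def borel_equiv_rel_def)
  have symR: "sym R" and transR: "trans R" and symS: "sym S" and transS: "trans S"
    using R(2) S(2) by (auto simp: equiv_def)
  have reflS: "(x, x) \<in> S" if "x \<in> space X" for x
    using S(2) that by (auto simp: equiv_def refl_on_def)
  obtain G where G: "G \<in> sets (X \<Otimes>\<^sub>M X)" "sym G" "G \<inter> Id = {}" "graph_acyclic G"
      "graph_components (space X) G = space X // R"
    using assms(4) by (auto simp: arborable_def)
  have GX: "G \<subseteq> space X \<times> space X"
    using sets.sets_into_space[OF G(1)] by (simp add: space_pair_measure)
  \<comment> \<open>Equality of the two families only makes the component of \<open>x\<close> some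
    \<open>R\<close>-class; as it contains \<open>x\<close>, it is the class of
    \<open>x\<close>.\<close>
  have G_R: "G\<^sup>* `` {x} = R `` {x}" if x: "x \<in> space X" for x
  proof -
    have "G\<^sup>* `` {x} \<in> graph_components (space X) G"
      using x unfolding graph_components_def by blast
    then have "G\<^sup>* `` {x} \<in> space X // R" using G(5) by simp
    then obtain w where w: "w \<in> space X" "G\<^sup>* `` {x} = R `` {w}" by (rule quotientE)
    then have "(w, x) \<in> R" by blast
    then show ?thesis using w(2) equiv_class_eq[OF R(2)] by metis
  qed
  have "G \<subseteq> R"
  proof (rule subrelI)
    fix y z assume yz: "(y, z) \<in> G"
    then have "y \<in> space X" using GX by blast
    then show "(y, z) \<in> R" using yz G_R by blast
  qed
  have "countable (R `` {x})" if "x \<in> space X" for x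
    using assms(3) quotientI[OF that] by (auto simp: countable_classes_def)
  then obtain g :: "nat \<Rightarrow> 'a \<Rightarrow> 'a"
    where g: "\<And>n. g n \<in> X \<rightarrow>\<^sub>M X" "\<And>x y. (x, y) \<in> R \<Longrightarrow> \<exists>n. y = g n x"
    using that by (rule countable_sections_covered_by_functions[OF assms(1) R(1)])
  have gG: "\<exists>k. z = g k y" if "(y, z) \<in> G" for y z
    using g(2) that \<open>G \<subseteq> R\<close> by blast
  let ?r = "\<lambda>x. cell_root G g (S `` {x})"
  have r_inv: "?r x = ?r x'" if "(x, x') \<in> S" for x x'
    using equiv_class_eq[OF S(2) that] by simp
  have r_fix: "?r x y = y" if "(x, y) \<in> S" for x y
    using that by (intro cell_root_of_mem) simp
  have r: "(x, ?r x y) \<in> S" "(y, ?r x y) \<in> {(y, z) \<in> G. ?r x y = ?r x z}\<^sup>*"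
    if xy: "(x, y) \<in> R" for x y
  proof -
    have "y \<in> space X" "x \<in> space X" using equiv_type[OF R(2)] xy by blast+
    have "(y, x) \<in> G\<^sup>*" using G_R[OF \<open>y \<in> space X\<close>] symD[OF symR xy] by blast
    moreover have "x \<in> S `` {x}" using reflS[OF \<open>x \<in> space X\<close>] by simp
    ultimately show "(x, ?r x y) \<in> S" "(y, ?r x y) \<in> {(y, z) \<in> G. ?r x y = ?r x z}\<^sup>*"
      using cell_root_mem_and_path[of G g y x "S `` {x}", OF gG G(2)] by simp_all
  qed
  define H where "H = contracted_graph G g R S"
  have H_iff: "(a, b) \<in> H \<longleftrightarrow> (a, b) \<in> S \<and> a \<noteq> b \<and>
      (\<exists>y z. (y, z) \<in> G \<and> (a, y) \<in> R \<and> ?r a y = a \<and> ?r a z = b)" for a b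
    by (simp add: H_def contracted_graph_def)
  have "H \<in> sets (X \<Otimes>\<^sub>M X)"
    unfolding H_def using assms(1) S(1) G(1) R(1) transR \<open>G \<subseteq> R\<close> g
    by (rule measurable_contracted_graph)
  moreover have "sym H"
  proof (rule symI)
    fix a b assume ab: "(a, b) \<in> H"
    then obtain y z where yz: "(a, b) \<in> S" "a \<noteq> b" "(y, z) \<in> G" "(a, y) \<in> R" "?r a y = a" "?r a z = b"
      unfolding H_iff by blast
    have "(b, a) \<in> S" using symS yz(1) by (rule symD)
    moreover have "(b, z) \<in> R"
    proof -
      have "(b, a) \<in> R" "(y, z) \<in> R" using \<open>(b, a) \<in> S\<close> S(3) yz(3) \<open>G \<subseteq> R\<close> by blast+
      then show ?thesis using yz(4) transD[OF transR] by blast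
    qed
    ultimately show "(b, a) \<in> H"
      unfolding H_iff using yz symD[OF G(2) yz(3)] r_inv[OF yz(1)] by auto
  qed
  moreover have "H \<inter> Id = {}" by (auto simp: H_iff)
  moreover have "graph_acyclic H"
    unfolding graph_acyclic_def
  proof
    assume "\<exists>p. graph_cycle H p"
    then obtain p where p: "graph_cycle H p" ..
    define x where "x = p ! 0"
    have len: "3 \<le> length p" and edges: "\<And>i. i < length p \<Longrightarrow> (p ! i, p ! (Suc i mod length p)) \<in> H"
      using p by (simp_all add: graph_cycle_def)
    have "(p ! 0, p ! (Suc 0 mod length p)) \<in> H" using len by (intro edges) linarith
    then have "x \<in> space X" using equiv_type[OF S(2)] unfolding x_def H_iff by blast
    have xp: "(x, p ! i) \<in> S" if "i < length p" for i
      using that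
    proof (induction i)
      case 0
      then show ?case using reflS[OF \<open>x \<in> space X\<close>] by (simp add: x_def)
    next
      case (Suc i)
      then have "(p ! i, p ! Suc i) \<in> S" using edges[of i] by (simp add: H_iff)
      then show ?case using Suc transD[OF transS] by (meson Suc_lessD)
    qed
    \<comment> \<open>Each edge of \<open>H\<close> is defined from its own starting point. All
      vertices of the cycle are \<open>S\<close>-equivalent to \<open>x\<close>, so the whole cycle
      can be read in the contraction based at \<open>x\<close>.\<close>
    define K where "K = {(?r x y, ?r x z) | y z. (y, z) \<in> G \<and> y \<in> R `` {x} \<and> ?r x y \<noteq> ?r x z}"
    have "(p ! i, p ! (Suc i mod length p)) \<in> K" if i: "i < length p" for i
    proof -
      obtain y z where yz: "p ! i \<noteq> p ! (Suc i mod length p)" "(y, z) \<in> G" "(p ! i, y) \<in> R"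
          "?r (p ! i) y = p ! i" "?r (p ! i) z = p ! (Suc i mod length p)"
        using edges[OF i] unfolding H_iff by blast
      have "(x, y) \<in> R" using xp[OF i] S(3) yz(3) transD[OF transR] by blast
      then show ?thesis
        using yz r_inv[OF xp[OF i]] unfolding K_def by force
    qed
    then have "graph_cycle K p" using p by (simp add: graph_cycle_def)
    moreover have "graph_acyclic K"
      unfolding K_def
    proof (rule graph_acyclic_contraction[OF G(2,3,4)])
      show "z \<in> R `` {x}" if "(y, z) \<in> G" "y \<in> R `` {x}" for y z
        using that \<open>G \<subseteq> R\<close> transD[OF transR] by blast
      show "(y, ?r x y) \<in> {(y, z) \<in> G. ?r x y = ?r x z}\<^sup>*" if "y \<in> R `` {x}" for y
        using that by (intro r(2)) simp
    qed
    ultimately show False by (auto simp: graph_acyclic_def)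
  qed
  moreover have "graph_components (space X) H = space X // S"
  proof -
    have "H\<^sup>* `` {x} = S `` {x}" if x: "x \<in> space X" for x
    proof (intro equalityI subsetI)
      fix y assume "y \<in> H\<^sup>* `` {x}"
      then have "(x, y) \<in> H\<^sup>*" by simp
      then have "(x, y) \<in> S"
      proof induction
        case base
        then show ?case using reflS[OF x] .
      next
        case (step y z)
        then show ?case using transD[OF transS] unfolding H_iff by blast
      qed
      then show "y \<in> S `` {x}" by simp
    next
      fix y assume "y \<in> S `` {x}"
      then have xy: "(x, y) \<in> S" by simp
      then have "(x, y) \<in> G\<^sup>*" using S(3) G_R[OF x] by blast
      \<comment> \<open>The root map sends a walk in \<open>G\<close> to a walk in \<open>H\<close>:
        each step stays in a cell or crosses to another along an edge of \<open>H\<close>. Since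
        \<open>y\<close> lies in the class of \<open>x\<close>, the walk ends at \<open>y\<close>
        itself.\<close>
      then have "(x, ?r x y) \<in> H\<^sup>*"
      proof induction
        case base
        then show ?case using r_fix[OF reflS[OF x]] by simp
      next
        case (step y z)
        have xy: "(x, y) \<in> R" and xz: "(x, z) \<in> R"
          using step.hyps G_R[OF x] by (auto intro: rtrancl_into_rtrancl)
        show ?case
        proof (cases "?r x y = ?r x z")
          case True
          then show ?thesis using step.IH by simp
        next
          case False
          have "(?r x y, x) \<in> S" using symS r(1)[OF xy] by (rule symD)
          then have "(?r x y, ?r x z) \<in> S" "(?r x y, y) \<in> R"
            using r(1)[OF xz] xy S(3) transD[OF transS] transD[OF transR] by blast+
          \<comment> \<open>\<open>r_inv\<close> moves the base point from \<open>x\<close> to the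
            root of \<open>y\<close>, the starting point of the new edge.\<close>
          then have "(?r x y, ?r x z) \<in> H"
            using False step.hyps(2) r_inv[OF r(1)[OF xy]] unfolding H_iff by auto
          then show ?thesis using step.IH by (rule rtrancl_into_rtrancl[rotated])
        qed
      qed
      then show "y \<in> H\<^sup>* `` {x}" using r_fix[OF xy] by simp
    qed
    then show ?thesis by (auto simp: graph_components_def quotient_def)
  qed
  ultimately show ?thesis unfolding arborable_def by blast
qed

end
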